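(* Let $d\ge1$, $s\in(0,1)$, let $u_0\in H^s(\mathbb{R}^d)$ be measurable and nonnegative with $\int_{\mathbb{R}^d}u_0\log u_0\,dx<+\infty$, and let $u$ be a weak solution, constructed as in the existence theorem (recalled in the context), of $\partial_tu=\mathrm{div}(u\nabla p)$, $p=(-\Delta)^su$, with initial datum $u_0$. Then $$\int_{\mathbb{R}^d}|x|\,u(x,t)\,dx\le\int_{\mathbb{R}^d}|x|\,u_0(x)\,dx+C(T)\qquad\text{for a.a. }t\le T ,$$ where $C(T)$ is a constant depending on the final time $T>0$.
   Context: $(-\Delta)^s$ is the fractional Laplacian on $\mathbb{R}^d$ (Fourier multiplier $|\xi|^{2s}$); $(-\Delta)^{s/2}\nabla u$ is taken componentwise; $0\log0=0$; $\mathscr{F}(v)=\int_{\mathbb{R}^d}v\log v$; $Q=\mathbb{R}^d\times(0,+\infty)$. Weak solution with initial datum $u_0$: (i) $u\ge0$ a.e. in $Q$; (ii) $u\in L^\infty(0,+\infty;H^s(\mathbb{R}^d))\cap L^2(0,+\infty;H^{1+s}(\mathbb{R}^d))$; (iii) $p=(-\Delta)^su\in L^2(0,+\infty;H^{1-s}(\mathbb{R}^d))$; (iv) for all $\varphi\in C_c^\infty(\mathbb{R}^d\times[0,+\infty))$, $-\iint_Qu\,\partial_t\varphi-\iint_Qp\,u\,\Delta\varphi-\iint_Qp\,\nabla u\cdot\nabla\varphi=\int_{\mathbb{R}^d}u_0\varphi(x,0)\,dx$. Existence theorem: for $u_0$ as in the claim there is a weak solution $u$ that also satisfies, for a.a.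 $t>0$: (1) $\int u(x,t)dx=\int u_0\,dx$; (2) $\mathscr{F}(u(t))+\int_0^t\int|(-\Delta)^{s/2}\nabla u|^2dx\,dr\le\mathscr{F}(u_0)$; (3) $\frac12\int|(-\Delta)^{s/2}u(t)|^2dx+\int_0^t\int|\xi|^2dx\,dr\le\frac12\int|(-\Delta)^{s/2}u_0|^2dx$, where the vector field $\xi\in L^2(0,+\infty;L^2(\mathbb{R}^d))$ satisfies $\nabla(up)-p\nabla u=u^{1/2}\xi$ a.e. in $Q$. It is constructed by approximation: with $m_\varepsilon(y)=y^++\varepsilon$ and $m_\varepsilon^M=\min\{M,m_\varepsilon\}$ one solves $\partial_tu=\mathrm{div}(m_\varepsilon^M(u)\nabla p)$, $p=(-\Delta)^su$, $u(\cdot,0)=u_0$ (by implicit Euler time discretisation on balls $B_R(0)$ with $u=0$ outside $B_R(0)$ and initial data converging to $u_0$ in $H^s$, letting the time step go to $0$ and then $R\to+\infty$), then lets $M\to+\infty$ to get $u_\varepsilon$ solving the problem with mobility $m_\varepsilon$, and finally $u=\lim u_\varepsilon$ along a subsequence $\varepsilon\to0$. *)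

theory Defs
  imports "HOL-Analysis.Analysis"
begin

text \<open>
  Conventions. Equivalence classes of Lebesgue measurable functions are represented by Borel
  functions. Functions on space-time take pairs \<open>(x, t)\<close>; their values at \<open>t \<le> 0\<close> are irrelevant.
  Integrals of nonnegative functions that may be infinite are nonnegative integrals.
\<close>

section \<open>Test functions\<close>

primrec C_k :: "nat \<Rightarrow> ('a::real_normed_vector \<Rightarrow> real) \<Rightarrow> bool" where
  "C_k 0 f \<longleftrightarrow> continuous_on UNIV f"
| "C_k (Suc k) f \<longleftrightarrow>
     (\<forall>x. f differentiable (at x)) \<and> (\<forall>v. C_k k (\<lambda>x. frechet_derivative f (at x) v))"

definition test_fun :: "'a::real_normed_vector set \<Rightarrow> ('a \<Rightarrow> real) \<Rightarrow> bool" where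
  "test_fun S \<phi> \<longleftrightarrow>
     (\<forall>k. C_k k \<phi>) \<and> compact (closure {z. \<phi> z \<noteq> 0}) \<and> closure {z. \<phi> z \<noteq> 0} \<subseteq> S"

definition Q :: "('a::euclidean_space \<times> real) set" where
  "Q = UNIV \<times> {0<..}"

definition dt :: "('a::euclidean_space \<times> real \<Rightarrow> real) \<Rightarrow> 'a \<times> real \<Rightarrow> real" where
  "dt \<phi> z = frechet_derivative \<phi> (at z) (0, 1)"

definition dx :: "'a::euclidean_space \<Rightarrow> ('a \<times> real \<Rightarrow> real) \<Rightarrow> 'a \<times> real \<Rightarrow> real" where
  "dx b \<phi> z = frechet_derivative \<phi> (at z) (b, 0)"

definition grad_x :: "('a::euclidean_space \<times> real \<Rightarrow> real) \<Rightarrow> 'a \<times> real \<Rightarrow> 'a" where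
  "grad_x \<phi> z = (\<Sum>b\<in>Basis. dx b \<phi> z *\<^sub>R b)"

definition laplace_x :: "('a::euclidean_space \<times> real \<Rightarrow> real) \<Rightarrow> 'a \<times> real \<Rightarrow> real" where
  "laplace_x \<phi> z = (\<Sum>b\<in>Basis. dx b (dx b \<phi>) z)"


section \<open>Fourier transform, fractional Laplacian, Sobolev spaces\<close>

definition L2_fun :: "('a::euclidean_space \<Rightarrow> 'b::{real_normed_vector, second_countable_topology}) \<Rightarrow> bool"
  where "L2_fun f \<longleftrightarrow> f \<in> borel_measurable borel \<and> integrable lborel (\<lambda>x. (norm (f x))\<^sup>2)"

text \<open>The Fourier transform on \<open>L\<^sup>2\<close>: the \<open>L\<^sup>2\<close> limit of the transforms of the truncations of \<open>f\<close>.\<close>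

definition has_fourier :: "('a::euclidean_space \<Rightarrow> real) \<Rightarrow> ('a \<Rightarrow> complex) \<Rightarrow> bool" where
  "has_fourier f g \<longleftrightarrow> L2_fun f \<and> L2_fun g \<and>
     ((\<lambda>R. \<integral>\<^sup>+\<xi>. ennreal ((cmod (g \<xi> -
         (LINT x:ball 0 R|lborel. exp (- \<i> * complex_of_real (x \<bullet> \<xi>)) * complex_of_real (f x))))\<^sup>2)
       \<partial>lborel) \<longlongrightarrow> 0) at_top"

definition fourier :: "('a::euclidean_space \<Rightarrow> real) \<Rightarrow> 'a \<Rightarrow> complex" where
  "fourier f = (SOME g. has_fourier f g)"

definition is_frac_lap :: "real \<Rightarrow> ('a::euclidean_space \<Rightarrow> real) \<Rightarrow> ('a \<Rightarrow> real) \<Rightarrow> bool" where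
  "is_frac_lap \<sigma> f g \<longleftrightarrow>
     (\<exists>F. has_fourier f F \<and>
          has_fourier g (\<lambda>\<xi>. complex_of_real (norm \<xi> powr (2 * \<sigma>)) * F \<xi>))"

text \<open>\<open>(-\<Delta>)\<^sup>\<sigma> f\<close> for \<open>f \<in> H\<^bsup>2\<sigma>\<^esup>\<close>, where it is unique up to null sets; the value 0 off this domain is
  only there to make the operator total.\<close>

definition frac_lap :: "real \<Rightarrow> ('a::euclidean_space \<Rightarrow> real) \<Rightarrow> 'a \<Rightarrow> real" where
  "frac_lap \<sigma> f =
     (if \<exists>g. is_frac_lap \<sigma> f g then SOME g. is_frac_lap \<sigma> f g else (\<lambda>_. 0))"

definition sobolev_norm2 :: "real \<Rightarrow> ('a::euclidean_space \<Rightarrow> real) \<Rightarrow> ennreal" where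
  "sobolev_norm2 r f = (\<integral>\<^sup>+\<xi>. ennreal ((1 + (norm \<xi>)\<^sup>2) powr r * (cmod (fourier f \<xi>))\<^sup>2) \<partial>lborel)"

text \<open>\<open>H\<^sup>r\<close>; only used for \<open>r \<ge> 0\<close>, where it is contained in \<open>L\<^sup>2\<close>.\<close>

definition sobolev :: "real \<Rightarrow> ('a::euclidean_space \<Rightarrow> real) \<Rightarrow> bool" where
  "sobolev r f \<longleftrightarrow> L2_fun f \<and> sobolev_norm2 r f < \<infinity>"

definition Linf_sobolev :: "real \<Rightarrow> ('a::euclidean_space \<times> real \<Rightarrow> real) \<Rightarrow> bool" where
  "Linf_sobolev r u \<longleftrightarrow> u \<in> borel_measurable borel \<and>
     (\<exists>B::real. AE t in lborel. 0 < t \<longrightarrow>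
        sobolev r (\<lambda>x. u (x, t)) \<and> sobolev_norm2 r (\<lambda>x. u (x, t)) \<le> ennreal B)"

definition L2_sobolev :: "real \<Rightarrow> ('a::euclidean_space \<times> real \<Rightarrow> real) \<Rightarrow> bool" where
  "L2_sobolev r u \<longleftrightarrow> u \<in> borel_measurable borel \<and>
     (AE t in lborel. 0 < t \<longrightarrow> sobolev r (\<lambda>x. u (x, t))) \<and>
     (\<integral>\<^sup>+t\<in>{0<..}. sobolev_norm2 r (\<lambda>x. u (x, t)) \<partial>lborel) < \<infinity>"


section \<open>Weak spatial gradient on \<open>Q\<close>\<close>

text \<open>Local integrability up to and including the initial time.\<close>

definition loc_integrable ::
    "('a::euclidean_space \<times> real \<Rightarrow> 'b::{banach, second_countable_topology}) \<Rightarrow> bool" where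
  "loc_integrable f \<longleftrightarrow> f \<in> borel_measurable borel \<and>
     (\<forall>K. compact K \<longrightarrow> set_integrable lborel (K \<inter> Q) f)"

definition weak_grad_x ::
    "('a::euclidean_space \<times> real \<Rightarrow> real) \<Rightarrow> ('a \<times> real \<Rightarrow> 'a) \<Rightarrow> bool" where
  "weak_grad_x f G \<longleftrightarrow> loc_integrable f \<and> loc_integrable G \<and>
     (\<forall>\<phi>. test_fun Q \<phi> \<longrightarrow> (\<forall>b\<in>Basis.
        (LINT z:Q|lborel. f z * dx b \<phi> z) = - (LINT z:Q|lborel. (G z \<bullet> b) * \<phi> z)))"


section \<open>Weak solutions\<close>

text \<open>\<open>Du\<close> stands for the spatial gradient of \<open>u\<close>. The test functions in \<open>C\<^sub>c\<^sup>\<infinity>(\<real>\<^sup>d \<times> [0,\<infinity>))\<close> are the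
  restrictions to \<open>t \<ge> 0\<close> of the test functions on \<open>\<real>\<^sup>d \<times> \<real>\<close>.\<close>

definition weak_solution ::
    "real \<Rightarrow> ('a::euclidean_space \<Rightarrow> real) \<Rightarrow> ('a \<times> real \<Rightarrow> real) \<Rightarrow> ('a \<times> real \<Rightarrow> real)
      \<Rightarrow> ('a \<times> real \<Rightarrow> 'a) \<Rightarrow> bool" where
  "weak_solution s u0 u p Du \<longleftrightarrow>
     (AE z in lborel. z \<in> Q \<longrightarrow> 0 \<le> u z) \<and>
     Linf_sobolev s u \<and> L2_sobolev (1 + s) u \<and> weak_grad_x u Du \<and>
     (AE t in lborel. 0 < t \<longrightarrow> is_frac_lap s (\<lambda>x. u (x, t)) (\<lambda>x. p (x, t))) \<and>
     L2_sobolev (1 - s) p \<and>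
     (\<forall>\<phi>. test_fun UNIV \<phi> \<longrightarrow>
        - (LINT z:Q|lborel. u z * dt \<phi> z)
        - (LINT z:Q|lborel. p z * u z * laplace_x \<phi> z)
        - (LINT z:Q|lborel. p z * (Du z \<bullet> grad_x \<phi> z))
        = (LINT x|lborel. u0 x * \<phi> (x, 0)))"


section \<open>Mass, entropy and energy\<close>

text \<open>\<open>\<integral> v log v\<close> as an extended real number. The positive part is finite for \<open>v \<in> L\<^sup>2\<close>, \<open>v \<ge> 0\<close>.
  Since \<open>ln 0 = 0\<close> the convention \<open>0 log 0 = 0\<close> holds.\<close>

definition entropy :: "('a::euclidean_space \<Rightarrow> real) \<Rightarrow> ereal" where
  "entropy v = enn2ereal (\<integral>\<^sup>+x. ennreal (v x * ln (v x)) \<partial>lborel)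
             - enn2ereal (\<integral>\<^sup>+x. ennreal (- (v x * ln (v x))) \<partial>lborel)"

definition mass_conservation ::
    "('a::euclidean_space \<Rightarrow> real) \<Rightarrow> ('a \<times> real \<Rightarrow> real) \<Rightarrow> bool" where
  "mass_conservation u0 u \<longleftrightarrow> (AE t in lborel. 0 < t \<longrightarrow>
     (\<integral>\<^sup>+x. ennreal (u (x, t)) \<partial>lborel) = (\<integral>\<^sup>+x. ennreal (u0 x) \<partial>lborel))"

definition entropy_estimate ::
    "real \<Rightarrow> ('a::euclidean_space \<Rightarrow> real) \<Rightarrow> ('a \<times> real \<Rightarrow> real) \<Rightarrow> ('a \<times> real \<Rightarrow> 'a) \<Rightarrow> bool" where
  "entropy_estimate s u0 u Du \<longleftrightarrow> (AE t in lborel. 0 < t \<longrightarrow>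
     entropy (\<lambda>x. u (x, t))
     + enn2ereal (\<integral>\<^sup>+r\<in>{0<..t}. (\<Sum>b\<in>Basis.
         \<integral>\<^sup>+x. ennreal ((frac_lap (s / 2) (\<lambda>y. Du (y, r) \<bullet> b) x)\<^sup>2) \<partial>lborel) \<partial>lborel)
     \<le> entropy u0)"

text \<open>\<open>G\<close> is the distributional spatial gradient of \<open>u p\<close>.\<close>

definition energy_estimate ::
    "real \<Rightarrow> ('a::euclidean_space \<Rightarrow> real) \<Rightarrow> ('a \<times> real \<Rightarrow> real) \<Rightarrow> ('a \<times> real \<Rightarrow> real)
      \<Rightarrow> ('a \<times> real \<Rightarrow> 'a) \<Rightarrow> bool" where
  "energy_estimate s u0 u p Du \<longleftrightarrow> (\<exists>\<xi> G.
     \<xi> \<in> borel_measurable borel \<and>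
     (\<integral>\<^sup>+r\<in>{0<..}. (\<integral>\<^sup>+x. ennreal ((norm (\<xi> (x, r)))\<^sup>2) \<partial>lborel) \<partial>lborel) < \<infinity> \<and>
     weak_grad_x (\<lambda>z. u z * p z) G \<and>
     (AE z in lborel. z \<in> Q \<longrightarrow> G z - p z *\<^sub>R Du z = sqrt (u z) *\<^sub>R \<xi> z) \<and>
     (AE t in lborel. 0 < t \<longrightarrow>
        ennreal (1/2) * (\<integral>\<^sup>+x. ennreal ((frac_lap (s / 2) (\<lambda>y. u (y, t)) x)\<^sup>2) \<partial>lborel)
        + (\<integral>\<^sup>+r\<in>{0<..t}. (\<integral>\<^sup>+x. ennreal ((norm (\<xi> (x, r)))\<^sup>2) \<partial>lborel) \<partial>lborel)
        \<le> ennreal (1/2) * (\<integral>\<^sup>+x. ennreal ((frac_lap (s / 2) u0 x)\<^sup>2) \<partial>lborel)))"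


section \<open>Construction by approximation\<close>

definition mob :: "real \<Rightarrow> real \<Rightarrow> real" where
  "mob \<epsilon> y = max y 0 + \<epsilon>"

definition mob_trunc :: "real \<Rightarrow> real \<Rightarrow> real \<Rightarrow> real" where
  "mob_trunc M \<epsilon> y = min M (mob \<epsilon> y)"

definition loc_converges ::
    "(nat \<Rightarrow> 'a::euclidean_space \<times> real \<Rightarrow> real) \<Rightarrow> ('a \<times> real \<Rightarrow> real) \<Rightarrow> bool" where
  "loc_converges w u \<longleftrightarrow> (\<forall>n. w n \<in> borel_measurable borel) \<and> u \<in> borel_measurable borel \<and>
     (\<forall>K. compact K \<and> K \<subseteq> Q \<longrightarrow>
        (\<lambda>n. \<integral>\<^sup>+z\<in>K. ennreal \<bar>w n z - u z\<bar> \<partial>lborel) \<longlonglongrightarrow> 0)"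

text \<open>Implicit Euler scheme on the ball, with \<open>U k\<close> the approximation at time \<open>k \<tau>\<close>. Both
  \<open>P = (-\<Delta>)\<^sup>s U\<close> and the equation hold in the sense of distributions in the ball (\<open>U\<close> is only
  in \<open>H\<^sup>s\<close>, so \<open>(-\<Delta>)\<^sup>s U\<close> is put on the test function); \<open>G\<close> is the gradient of \<open>P\<close>.\<close>

definition euler_step ::
    "real \<Rightarrow> (real \<Rightarrow> real) \<Rightarrow> real \<Rightarrow> real \<Rightarrow> ('a::euclidean_space \<Rightarrow> real) \<Rightarrow> ('a \<Rightarrow> real) \<Rightarrow> bool" where
  "euler_step s m R \<tau> U U' \<longleftrightarrow> (\<exists>P G.
     P \<in> borel_measurable borel \<and> set_integrable lborel (ball 0 R) (\<lambda>x. (P x)\<^sup>2) \<and>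
     G \<in> borel_measurable borel \<and> set_integrable lborel (ball 0 R) (\<lambda>x. (norm (G x))\<^sup>2) \<and>
     (\<forall>\<phi>. test_fun (ball 0 R) \<phi> \<longrightarrow>
        (LINT x:ball 0 R|lborel. P x * \<phi> x) = (LINT x|lborel. U' x * frac_lap s \<phi> x) \<and>
        (\<forall>b\<in>Basis. (LINT x:ball 0 R|lborel. P x * frechet_derivative \<phi> (at x) b)
                   = - (LINT x:ball 0 R|lborel. (G x \<bullet> b) * \<phi> x)) \<and>
        (LINT x:ball 0 R|lborel. (U' x - U x) / \<tau> * \<phi> x)
        = - (LINT x:ball 0 R|lborel. m (U' x) * frechet_derivative \<phi> (at x) (G x))))"

definition euler_scheme ::
    "real \<Rightarrow> (real \<Rightarrow> real) \<Rightarrow> real \<Rightarrow> real \<Rightarrow> ('a::euclidean_space \<Rightarrow> real) \<Rightarrow> (nat \<Rightarrow> 'a \<Rightarrow> real) \<Rightarrow> bool"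
  where
  "euler_scheme s m R \<tau> v U \<longleftrightarrow> U 0 = v \<and>
     (\<forall>k. sobolev s (U k) \<and> (AE x in lborel. x \<notin> ball 0 R \<longrightarrow> U k x = 0) \<and>
          euler_step s m R \<tau> (U k) (U (Suc k)))"

definition interpolant :: "real \<Rightarrow> (nat \<Rightarrow> 'a \<Rightarrow> real) \<Rightarrow> 'a \<times> real \<Rightarrow> real" where
  "interpolant \<tau> U = (\<lambda>(x, t). U (nat \<lceil>t / \<tau>\<rceil>) x)"

definition ball_limit ::
    "real \<Rightarrow> (real \<Rightarrow> real) \<Rightarrow> real \<Rightarrow> ('a::euclidean_space \<Rightarrow> real) \<Rightarrow> ('a \<times> real \<Rightarrow> real) \<Rightarrow> bool" where
  "ball_limit s m R v u \<longleftrightarrow> (\<exists>\<tau> U. (\<forall>n. 0 < \<tau> n) \<and> \<tau> \<longlonglongrightarrow> 0 \<and>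
     (\<forall>n. euler_scheme s m R (\<tau> n) v (U n)) \<and>
     loc_converges (\<lambda>n. interpolant (\<tau> n) (U n)) u)"

text \<open>Weak solutions on \<open>\<real>\<^sup>d\<close> of \<open>\<partial>\<^sub>t u = div (m(u) \<nabla>p)\<close>, \<open>p = (-\<Delta>)\<^sup>s u\<close>, \<open>u(0) = u0\<close>, with the minimal
  regularity that gives the equation a meaning.\<close>

definition mobility_solution ::
    "real \<Rightarrow> (real \<Rightarrow> real) \<Rightarrow> ('a::euclidean_space \<Rightarrow> real) \<Rightarrow> ('a \<times> real \<Rightarrow> real) \<Rightarrow> bool" where
  "mobility_solution s m u0 u \<longleftrightarrow> (\<exists>p G.
     loc_integrable u \<and> weak_grad_x p G \<and> loc_integrable (\<lambda>z. m (u z) *\<^sub>R G z) \<and>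
     (AE t in lborel. 0 < t \<longrightarrow> sobolev s (\<lambda>x. u (x, t)) \<and>
        is_frac_lap s (\<lambda>x. u (x, t)) (\<lambda>x. p (x, t))) \<and>
     (\<forall>\<phi>. test_fun UNIV \<phi> \<longrightarrow>
        - (LINT z:Q|lborel. u z * dt \<phi> z) + (LINT z:Q|lborel. m (u z) * (G z \<bullet> grad_x \<phi> z))
        = (LINT x|lborel. u0 x * \<phi> (x, 0))))"

definition approx_trunc ::
    "real \<Rightarrow> real \<Rightarrow> real \<Rightarrow> ('a::euclidean_space \<Rightarrow> real) \<Rightarrow> ('a \<times> real \<Rightarrow> real) \<Rightarrow> bool" where
  "approx_trunc s M \<epsilon> u0 u \<longleftrightarrow> mobility_solution s (mob_trunc M \<epsilon>) u0 u \<and>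
     (\<exists>R v w. (\<forall>n. 0 < R n) \<and> filterlim R at_top sequentially \<and>
        (\<forall>n. sobolev s (v n)) \<and> (\<lambda>n. sobolev_norm2 s (\<lambda>x. v n x - u0 x)) \<longlonglongrightarrow> 0 \<and>
        (\<forall>n. ball_limit s (mob_trunc M \<epsilon>) (R n) (v n) (w n)) \<and>
        loc_converges w u)"

definition approx_eps ::
    "real \<Rightarrow> real \<Rightarrow> ('a::euclidean_space \<Rightarrow> real) \<Rightarrow> ('a \<times> real \<Rightarrow> real) \<Rightarrow> bool" where
  "approx_eps s \<epsilon> u0 u \<longleftrightarrow> mobility_solution s (mob \<epsilon>) u0 u \<and>
     (\<exists>M w. (\<forall>n. 0 < M n) \<and> filterlim M at_top sequentially \<and>
        (\<forall>n. approx_trunc s (M n) \<epsilon> u0 (w n)) \<and> loc_converges w u)"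

definition constructed ::
    "real \<Rightarrow> ('a::euclidean_space \<Rightarrow> real) \<Rightarrow> ('a \<times> real \<Rightarrow> real) \<Rightarrow> bool" where
  "constructed s u0 u \<longleftrightarrow>
     (\<exists>\<epsilon> w. (\<forall>n. 0 < \<epsilon> n) \<and> \<epsilon> \<longlonglongrightarrow> 0 \<and>
        (\<forall>n. approx_eps s (\<epsilon> n) u0 (w n)) \<and> loc_converges w u)"

end

theory Submission
  imports Defs
begin

text \<open>The energy estimate provides \<open>\<xi> \<in> L\<^sup>2\<close> with \<open>\<nabla>(u p) - p \<nabla>u = sqrt u \<xi>\<close>, so that the weak equation
  becomes \<open>\<partial>\<^sub>t u = div (sqrt u \<xi>)\<close>. For a weight \<open>\<psi>\<close> that approximates \<open>|x|\<close> and has gradient bounded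
  by \<open>L\<close>, the derivative of \<open>\<integral> \<psi> u\<close> is at most a multiple of \<open>L \<integral> sqrt u |\<xi>| \<le> L/2 \<integral> (u + |\<xi>|\<^sup>2)\<close>,
  whose time integral is controlled by mass conservation and the energy bound. Testing against
  smooth functions of time bounds the averages of \<open>\<integral> \<psi> u\<close> over intervals, Lebesgue differentiation
  turns this into a bound for almost every time, and Fatou's lemma removes the cutoff. If the first
  moment of \<open>u0\<close> is infinite there is nothing to prove; otherwise \<open>u0 \<in> L\<^sup>1\<close> because \<open>u0 \<in> L\<^sup>2\<close>.\<close>

section \<open>Smooth functions\<close>

text \<open>Three obstacles shape the argument. The weight |x| is neither smooth at 0 nor compactly
  supported; it is replaced by the identity, cut off at scale n, applied to sqrt(1 + |x|^2). Since
  cutoff and identity are rescaled together, the partial derivatives have a bound \<open>L\<close>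
  that does not see n. Next, the test functions of the equation need not vanish at t = 0, where they
  pick up the initial datum, whereas \<open>weak_grad_x\<close> integrates by parts only against
  test functions supported in t > 0; a limit in a time cutoff closes this gap. Finally, all the
  estimates hold only for almost every t and no continuity of u in time is available, so the values
  of u at a fixed time cannot be inserted into the equation; this is why averages over intervals
  come in, with a bound proportional to the length of the interval.

  The constant has to be the same for all solutions with datum \<open>u0\<close>. Everything that
  enters it (mass, first moment and energy of \<open>u0\<close>, the bound \<open>L\<close>, the
  dimension) is therefore fixed before u is introduced.\<close>

lemma C_k_SucI:
  assumes "\<And>x. (f has_derivative f' x) (at x)" "\<And>v. C_k k (\<lambda>x. f' x v)"
  shows "C_k (Suc k) f"
proof -
  have "frechet_derivative f (at x) = f' x" for x
    using frechet_derivative_at[OF assms(1)[of x]] by simp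
  then show ?thesis
    using assms by (auto simp: differentiable_def)
qed

lemma C_k_SucD:
  assumes "C_k (Suc k) f"
  shows "(f has_derivative frechet_derivative f (at x)) (at x)"
    and "C_k k (\<lambda>x. frechet_derivative f (at x) v)"
  using assms by (simp_all add: frechet_derivative_works[symmetric])

lemma C_k_pred: "C_k (Suc k) f \<Longrightarrow> C_k k f"
proof (induction k arbitrary: f)
  case 0
  then show ?case
    by (auto simp: continuous_on_eq_continuous_at intro: differentiable_imp_continuous_within)
next
  case (Suc k)
  then show ?case
    using C_k_SucD[OF Suc.prems] by (intro C_k_SucI[where f' = "\<lambda>x. frechet_derivative f (at x)"]) auto
qed

lemma smooth_continuous: "\<forall>k. C_k k f \<Longrightarrow> continuous_on A f"
  by (metis C_k.simps(1) continuous_on_subset subset_UNIV)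

lemma smooth_has_derivative:
  "\<forall>k. C_k k f \<Longrightarrow> (f has_derivative frechet_derivative f (at x)) (at x)"
  by (rule C_k_SucD(1)[of 0]) (rule spec)

lemma smooth_frechet: "\<forall>k. C_k k f \<Longrightarrow> \<forall>k. C_k k (\<lambda>x. frechet_derivative f (at x) v)"
  by (intro allI C_k_SucD(2)) (rule spec)

lemma C_k_const: "C_k k (\<lambda>_. c)"
proof (induction k arbitrary: c)
  case (Suc k)
  show ?case
    by (rule C_k_SucI[where f' = "\<lambda>_ _. 0"]) (use Suc in auto)
qed auto

lemma C_k_bounded_linear:
  assumes "bounded_linear l"
  shows "C_k k l"
proof (cases k)
  case 0
  then show ?thesis using assms by (simp add: linear_continuous_on)
next
  case (Suc k)
  show ?thesis unfolding Suc
    by (rule C_k_SucI[where f' = "\<lambda>_. l"])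
       (use assms bounded_linear_imp_has_derivative C_k_const in auto)
qed

lemma C_k_add:
  assumes "C_k k f" "C_k k g"
  shows "C_k k (\<lambda>x. f x + g x)"
  using assms
proof (induction k arbitrary: f g)
  case 0
  then show ?case by (auto intro: continuous_intros)
next
  case (Suc k)
  show ?case
    by (rule C_k_SucI[where f' = "\<lambda>x v. frechet_derivative f (at x) v + frechet_derivative g (at x) v"])
       (use C_k_SucD[OF Suc.prems(1)] C_k_SucD[OF Suc.prems(2)] Suc.IH in \<open>auto intro!: has_derivative_add\<close>)
qed

lemma C_k_mult:
  assumes "C_k k f" "C_k k g"
  shows "C_k k (\<lambda>x. f x * g x)"
  using assms
proof (induction k arbitrary: f g)
  case 0
  then show ?case by (auto intro: continuous_intros)
next
  case (Suc k)
  show ?case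
    by (rule C_k_SucI[where f' = "\<lambda>x v. f x * frechet_derivative g (at x) v + frechet_derivative f (at x) v * g x"])
       (use C_k_SucD[OF Suc.prems(1)] C_k_SucD[OF Suc.prems(2)] Suc.IH C_k_pred[OF Suc.prems(1)]
            C_k_pred[OF Suc.prems(2)] in \<open>auto intro!: has_derivative_mult C_k_add\<close>)
qed

lemma C_k_diff:
  assumes "C_k k f" "C_k k g"
  shows "C_k k (\<lambda>x. f x - g x)"
  using C_k_add[OF assms(1) C_k_mult[OF C_k_const[of k "-1"] assms(2)]] by simp

lemma C_k_compose_affine:
  assumes g: "\<And>x. (g has_derivative l) (at x)" and "C_k k f"
  shows "C_k k (\<lambda>x. f (g x))"
  using assms(2)
proof (induction k arbitrary: f)
  case 0
  have "continuous_on UNIV g"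
    using g by (meson continuous_at_imp_continuous_on has_derivative_continuous)
  with 0 show ?case
    by (auto intro: continuous_on_compose2)
next
  case (Suc k)
  show ?case
  proof (rule C_k_SucI[where f' = "\<lambda>x v. frechet_derivative f (at (g x)) (l v)"])
    show "((\<lambda>x. f (g x)) has_derivative (\<lambda>v. frechet_derivative f (at (g x)) (l v))) (at x)" for x
      by (rule has_derivative_compose[OF g C_k_SucD(1)[OF Suc.prems]])
    show "C_k k (\<lambda>x. frechet_derivative f (at (g x)) (l v))" for v
      by (rule Suc.IH[OF C_k_SucD(2)[OF Suc.prems]])
  qed
qed

text \<open>For \<open>g\<close> on the real line the derivative of the composite is the product of
  g'(f x) with f'(x) v, and \<open>C_k_mult\<close> closes the induction. Only \<open>g\<close> is
  generalised, because the inner function stays the same.\<close>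

lemma C_k_compose:
  fixes g :: "real \<Rightarrow> real"
  assumes "C_k k g" "C_k k f"
  shows "C_k k (\<lambda>x. g (f x))"
  using assms
proof (induction k arbitrary: g)
  case 0
  then show ?case by (auto intro: continuous_on_compose2)
next
  case (Suc k)
  show ?case
  proof (rule C_k_SucI[where f' = "\<lambda>x v. frechet_derivative f (at x) v * frechet_derivative g (at (f x)) 1"])
    fix x
    have g: "(g has_derivative frechet_derivative g (at (f x))) (at (f x))"
      by (rule C_k_SucD(1)[OF Suc.prems(1)])
    have "frechet_derivative g (at (f x)) c = c * frechet_derivative g (at (f x)) 1" for c
      using linear_scale[OF has_derivative_linear[OF g], of c 1] by simp
    then have "(\<lambda>v. frechet_derivative g (at (f x)) (frechet_derivative f (at x) v)) =
        (\<lambda>v. frechet_derivative f (at x) v * frechet_derivative g (at (f x)) 1)"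
      by (intro ext)
    with has_derivative_compose[OF C_k_SucD(1)[OF Suc.prems(2), of x] g]
    show "((\<lambda>x. g (f x)) has_derivative
        (\<lambda>v. frechet_derivative f (at x) v * frechet_derivative g (at (f x)) 1)) (at x)"
      by (rule has_derivative_eq_rhs)
  next
    show "C_k k (\<lambda>x. frechet_derivative f (at x) v * frechet_derivative g (at (f x)) 1)" for v
      by (rule C_k_mult[OF C_k_SucD(2)[OF Suc.prems(2)]
            Suc.IH[OF C_k_SucD(2)[OF Suc.prems(1)] C_k_pred[OF Suc.prems(2)]]])
  qed
qed

text \<open>The derivative -(1/f) f' (1/f) is built from f' and from 1/f itself, so the induction
  hypothesis for 1/f suffices. Square roots work the same way, through f'/(2 sqrt f).\<close>

lemma C_k_inverse:
  assumes "C_k k f" "\<And>x. f x \<noteq> 0"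
  shows "C_k k (\<lambda>x. inverse (f x))"
  using assms
proof (induction k)
  case 0
  then show ?case by (auto intro: continuous_intros)
next
  case (Suc k)
  have *: "C_k k (\<lambda>x. inverse (f x))" using Suc.IH[OF C_k_pred] Suc.prems by blast
  show ?case
  proof (rule C_k_SucI[where f' = "\<lambda>x v. (- 1) * (inverse (f x) * frechet_derivative f (at x) v * inverse (f x))"])
    show "((\<lambda>x. inverse (f x)) has_derivative
         (\<lambda>v. (- 1) * (inverse (f x) * frechet_derivative f (at x) v * inverse (f x)))) (at x)" for x
      using Deriv.has_derivative_inverse[OF _ C_k_SucD(1)[OF Suc.prems(1), of x]] Suc.prems(2)[of x] by simp
    show "C_k k (\<lambda>x. (- 1) * (inverse (f x) * frechet_derivative f (at x) v * inverse (f x)))" for v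
      by (intro C_k_mult C_k_const * C_k_SucD(2)[OF Suc.prems(1)])
  qed
qed

lemma C_k_sqrt:
  assumes "C_k k f" "\<And>x. 0 < f x"
  shows "C_k k (\<lambda>x. sqrt (f x))"
  using assms
proof (induction k)
  case 0
  then show ?case by (auto intro: continuous_intros)
next
  case (Suc k)
  have *: "C_k k (\<lambda>x. sqrt (f x))" using Suc.IH[OF C_k_pred] Suc.prems by blast
  show ?case
  proof (rule C_k_SucI[where f' = "\<lambda>x v. (1/2) * inverse (sqrt (f x)) * frechet_derivative f (at x) v"])
    show "((\<lambda>x. sqrt (f x)) has_derivative
         (\<lambda>v. (1/2) * inverse (sqrt (f x)) * frechet_derivative f (at x) v)) (at x)" for x
      using has_derivative_real_sqrt[OF Suc.prems(2) C_k_SucD(1)[OF Suc.prems(1), of x]]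
      by (simp add: field_simps)
    have "sqrt (f x) \<noteq> 0" for x using Suc.prems(2)[of x] by simp
    then show "C_k k (\<lambda>x. (1/2) * inverse (sqrt (f x)) * frechet_derivative f (at x) v)" for v
      by (intro C_k_mult C_k_inverse C_k_const * C_k_SucD(2)[OF Suc.prems(1)])
  qed
qed

lemma smooth_antiderivative:
  fixes F :: "real \<Rightarrow> real"
  assumes "\<forall>k. C_k k f" "\<And>x. (F has_real_derivative f x) (at x)"
  shows "\<forall>k. C_k k F"
proof
  fix k
  have "C_k (Suc k) F"
    by (rule C_k_SucI[where f' = "\<lambda>x v. f x * v"])
       (use assms in \<open>auto simp: has_field_derivative_def intro!: C_k_mult C_k_const\<close>)
  then show "C_k k F" by (rule C_k_pred)
qed

section \<open>A smooth transition function built from exp(-1/x)\<close>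

text \<open>\<open>flat 0\<close> is the classical smooth function exp(-1/x), extended by 0. The
  powers of 1/x are included because derivatives of \<open>flat n\<close> are linear combinations of
  members of the family, so that one induction over all n at once yields smoothness.\<close>

definition flat :: "nat \<Rightarrow> real \<Rightarrow> real" where
  "flat n x = (if x \<le> 0 then 0 else exp (- inverse x) * inverse x ^ n)"

lemma flat_tendsto_0: "(flat n \<longlongrightarrow> 0) (at 0)"
proof -
  have "((\<lambda>x. inverse x ^ n / exp (inverse x)) \<longlongrightarrow> (0::real)) (at_right 0)"
    by (rule filterlim_compose[OF tendsto_power_div_exp_0 filterlim_inverse_at_top_right])
  then have "(flat n \<longlongrightarrow> 0) (at_right 0)"
    by (rule Lim_transform_eventually)
       (auto simp: eventually_at_filter flat_def exp_minus field_simps)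
  moreover have "(flat n \<longlongrightarrow> 0) (at_left 0)"
    by (rule Lim_transform_eventually[OF tendsto_const])
       (auto simp: eventually_at_filter flat_def)
  ultimately show ?thesis by (simp add: filterlim_split_at)
qed

lemma flat_has_derivative:
  "(flat n has_real_derivative flat (n + 2) x - real n * flat (n + 1) x) (at x)"
proof (cases x "0::real" rule: linorder_cases)
  case less
  have "((\<lambda>_. 0) has_real_derivative 0) (at x)" by simp
  then have "(flat n has_real_derivative 0) (at x)"
    by (rule DERIV_cong_ev[THEN iffD1, rotated 3, OF _ refl _ refl])
       (use less in \<open>auto simp: flat_def intro!: eventually_mono[OF eventually_nhds_in_open[of "{..<0}" x]]\<close>)
  then show ?thesis using less by (simp add: flat_def)
next
  case equal
  \<comment> \<open>Dividing by y raises the index by one: away from 0 the difference quotient at 0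
    is \<open>flat (Suc n)\<close>.\<close>
  have "((\<lambda>y. (flat n y - flat n 0) / (y - 0)) \<longlongrightarrow> 0) (at 0)"
    by (rule Lim_transform_eventually[OF flat_tendsto_0[of "Suc n"]])
       (auto simp: eventually_at_filter flat_def field_simps)
  then show ?thesis using equal by (simp add: has_field_derivative_iff flat_def)
next
  case greater
  have e: "((\<lambda>x. exp (- inverse x)) has_real_derivative exp (- inverse x) * inverse x ^ 2) (at x)"
    using greater by (auto intro!: derivative_eq_intros simp: power2_eq_square)
  have i: "(inverse has_real_derivative - (inverse x ^ 2)) (at x)"
    using greater by (auto intro!: derivative_eq_intros simp: power2_eq_square)
  have p: "((\<lambda>x. inverse x ^ n) has_real_derivative - (real n * inverse x ^ (n + 1))) (at x)"
    using DERIV_power[OF i, of n] by (cases n) (simp_all add: power2_eq_square algebra_simps)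
  have "((\<lambda>x. exp (- inverse x) * inverse x ^ n) has_real_derivative
      flat (n + 2) x - real n * flat (n + 1) x) (at x)"
    using DERIV_mult[OF e p] greater by (simp add: flat_def power2_eq_square algebra_simps)
  then show ?thesis
    by (rule DERIV_cong_ev[THEN iffD1, rotated 3, OF _ refl _ refl])
       (use greater in \<open>auto simp: flat_def intro!: eventually_mono[OF eventually_nhds_in_open[of "{0<..}" x]]\<close>)
qed

lemma C_k_flat: "C_k k (flat n)"
proof (induction k arbitrary: n)
  case 0
  then show ?case
    using flat_has_derivative by (auto intro!: continuous_at_imp_continuous_on DERIV_isCont)
next
  case (Suc k)
  show ?case
    by (rule C_k_SucI[where f' = "\<lambda>x v. (flat (n + 2) x - real n * flat (n + 1) x) * v"])
       (use flat_has_derivative in \<open>auto simp: has_field_derivative_def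
          intro!: C_k_mult C_k_diff C_k_const Suc\<close>)
qed

text \<open>The standard smooth transition from 0 to 1 across the unit interval. All cutoffs below,
  in space and in time, are rescaled copies of it.\<close>

definition step :: "real \<Rightarrow> real" where
  "step y = flat 0 y * inverse (flat 0 y + flat 0 (1 - y))"

lemma step_denom_pos: "0 < flat 0 y + flat 0 (1 - y)"
  by (auto simp: flat_def add_pos_pos)

lemma step_eq_0: "y \<le> 0 \<Longrightarrow> step y = 0"
  by (simp add: step_def flat_def)

lemma step_eq_1: "1 \<le> y \<Longrightarrow> step y = 1"
  by (simp add: step_def flat_def)

lemma step_bounds: "0 \<le> step y" "step y \<le> 1"
proof -
  have "0 \<le> flat 0 y" "0 \<le> flat 0 (1 - y)" by (auto simp: flat_def)
  then show "0 \<le> step y" "step y \<le> 1"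
    using step_denom_pos[of y] by (auto simp: step_def field_simps)
qed

lemma smooth_step: "\<forall>k. C_k k step"
proof
  fix k
  have "C_k k (\<lambda>y. flat 0 (1 - y))"
    by (rule C_k_compose_affine[where l = "\<lambda>y. - y"]) (auto intro!: derivative_eq_intros C_k_flat)
  moreover have "flat 0 y + flat 0 (1 - y) \<noteq> 0" for y
    using step_denom_pos[of y] by linarith
  ultimately have "C_k k (\<lambda>y. flat 0 y * inverse (flat 0 y + flat 0 (1 - y)))"
    by (intro C_k_mult C_k_inverse C_k_add C_k_flat)
  then show "C_k k step" by (simp add: step_def[abs_def])
qed

text \<open>Arguments of \<open>step\<close> in later definitions are written as
  \<open>1 * t + 2\<close>, \<open>- 1 * r + 2\<close> and the like so that they match this
  pattern.\<close>

lemma C_k_step_affine: "C_k k (\<lambda>t. step (c * t + d))"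
  by (rule C_k_compose_affine[where f = step and l = "\<lambda>t. c * t", OF _ spec[OF smooth_step]])
     (auto intro!: derivative_eq_intros)


section \<open>Test functions and local integrability\<close>

lemma test_funI:
  assumes "\<forall>k. C_k k \<phi>" "compact K" "{z. \<phi> z \<noteq> 0} \<subseteq> K" "K \<subseteq> S"
  shows "test_fun S \<phi>"
proof -
  have "closure {z. \<phi> z \<noteq> 0} \<subseteq> K"
    using assms by (intro closure_minimal compact_imp_closed)
  moreover from this have "compact (closure {z. \<phi> z \<noteq> 0})"
    using compact_Int_closed[OF assms(2) closed_closure, of "{z. \<phi> z \<noteq> 0}"]
    by (simp add: inf.absorb2)
  ultimately show ?thesis
    using assms unfolding test_fun_def by auto
qed

lemma test_fun_smooth: "test_fun S \<phi> \<Longrightarrow> \<forall>k. C_k k \<phi>"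
  by (simp add: test_fun_def)

text \<open>The complement of the support is open and \<phi> is 0 there, so the derivative vanishes
  off the support as well and the same compact set serves.\<close>

lemma test_fun_frechet:
  assumes "test_fun S \<phi>"
  shows "test_fun S (\<lambda>z. frechet_derivative \<phi> (at z) v)"
proof (rule test_funI)
  let ?K = "closure {z. \<phi> z \<noteq> 0}"
  show "\<forall>k. C_k k (\<lambda>z. frechet_derivative \<phi> (at z) v)"
    by (rule smooth_frechet[OF test_fun_smooth[OF assms]])
  show "compact ?K" "?K \<subseteq> S" using assms by (auto simp: test_fun_def)
  show "{z. frechet_derivative \<phi> (at z) v \<noteq> 0} \<subseteq> ?K"
  proof (rule subsetI, rule ccontr)
    fix z assume z: "z \<in> {z. frechet_derivative \<phi> (at z) v \<noteq> 0}" "z \<notin> ?K"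
    have "((\<lambda>_. 0) has_derivative (\<lambda>_. 0)) (at z)" by simp
    then have "(\<phi> has_derivative (\<lambda>_. 0)) (at z)"
      by (rule has_derivative_transform_within_open[where s = "- ?K"])
         (use z closure_subset[of "{z. \<phi> z \<noteq> 0}"] in \<open>auto simp: open_Compl\<close>)
    then have "(\<lambda>_. 0) = frechet_derivative \<phi> (at z)"
      by (rule frechet_derivative_at)
    from fun_cong[OF this, of v] show False using z(1) by simp
  qed
qed

lemma test_fun_dx: "test_fun S \<phi> \<Longrightarrow> test_fun S (dx b \<phi>)"
  unfolding dx_def[abs_def] by (rule test_fun_frechet)

lemma test_fun_dt: "test_fun S \<phi> \<Longrightarrow> test_fun S (dt \<phi>)"
  unfolding dt_def[abs_def] by (rule test_fun_frechet)

lemma test_fun_continuous: "test_fun S \<phi> \<Longrightarrow> continuous_on A \<phi>"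
  by (intro smooth_continuous test_fun_smooth)

lemma test_fun_measurable [measurable_dest]:
  "test_fun S (\<phi> :: 'a::euclidean_space \<Rightarrow> real) \<Longrightarrow> \<phi> \<in> borel_measurable borel"
  by (intro borel_measurable_continuous_onI test_fun_continuous)

lemma test_fun_bounded:
  assumes "test_fun S (\<phi> :: 'a::real_normed_vector \<Rightarrow> real)"
  obtains B where "\<And>z. \<bar>\<phi> z\<bar> \<le> B"
proof -
  let ?K = "closure {z. \<phi> z \<noteq> 0}"
  have "compact (\<phi> ` ?K)"
    using assms test_fun_continuous[OF assms] by (intro compact_continuous_image) (auto simp: test_fun_def)
  then obtain B where B: "\<And>y. y \<in> \<phi> ` ?K \<Longrightarrow> norm y \<le> B"
    using compact_imp_bounded bounded_iff by metis
  have "\<bar>\<phi> z\<bar> \<le> max B 0" for z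
  proof (cases "\<phi> z = 0")
    case False
    then have "\<phi> z \<in> \<phi> ` ?K" using closure_subset by fastforce
    from B[OF this] show ?thesis by simp
  qed simp
  then show ?thesis by (rule that)
qed

lemma open_Q: "open (Q :: ('a::euclidean_space \<times> real) set)"
  unfolding Q_def by (intro open_Times) auto

lemma Q_measurable [measurable]: "Q \<in> sets borel"
  by (rule borel_open[OF open_Q])

text \<open>\<open>loc_integrable\<close> controls compact sets that touch t = 0, which admits test
  functions that do not vanish at the initial time.\<close>

lemma loc_integrable_test_fun:
  fixes f :: "'a::euclidean_space \<times> real \<Rightarrow> real"
  assumes "loc_integrable f" "test_fun UNIV \<phi>"
  shows "set_integrable lborel Q (\<lambda>z. f z * \<phi> z)"
proof -
  let ?K = "closure {z. \<phi> z \<noteq> 0}"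
  obtain B where B: "\<And>z. \<bar>\<phi> z\<bar> \<le> B" using test_fun_bounded[OF assms(2)] by metis
  have [measurable]: "f \<in> borel_measurable borel" "\<phi> \<in> borel_measurable borel"
    using assms test_fun_measurable by (auto simp: loc_integrable_def)
  have "set_integrable lborel (?K \<inter> Q) f"
    using assms by (auto simp: loc_integrable_def test_fun_def)
  then have "integrable lborel (\<lambda>z. B * (indicator (?K \<inter> Q) z *\<^sub>R f z))"
    by (simp add: set_integrable_def)
  then show ?thesis
    unfolding set_integrable_def
  proof (rule Bochner_Integration.integrable_bound)
    have "norm (indicator Q z *\<^sub>R (f z * \<phi> z)) \<le> norm (B * (indicator (?K \<inter> Q) z *\<^sub>R f z))" for z
    proof (cases "\<phi> z = 0 \<or> z \<notin> Q")
      case False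
      then have "z \<in> ?K \<inter> Q" using closure_subset by fastforce
      moreover have "\<bar>f z\<bar> * \<bar>\<phi> z\<bar> \<le> \<bar>B\<bar> * \<bar>f z\<bar>"
        using B[of z] by (subst mult.commute) (intro mult_right_mono, auto)
      ultimately show ?thesis by (simp add: abs_mult)
    qed auto
    then show "AE z in lborel. norm (indicator Q z *\<^sub>R (f z * \<phi> z))
        \<le> norm (B * (indicator (?K \<inter> Q) z *\<^sub>R f z))" by simp
  qed measurable
qed

lemma loc_integrable_inner:
  fixes V :: "'a::euclidean_space \<times> real \<Rightarrow> 'a"
  assumes "loc_integrable V"
  shows "loc_integrable (\<lambda>z. V z \<bullet> b)"
  unfolding loc_integrable_def
proof (intro conjI allI impI)
  show "(\<lambda>z. V z \<bullet> b) \<in> borel_measurable borel"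
    using assms by (auto simp: loc_integrable_def)
  fix K :: "('a \<times> real) set" assume "compact K"
  then have "integrable lborel (\<lambda>z. (indicator (K \<inter> Q) z *\<^sub>R V z) \<bullet> b)"
    using assms by (intro integrable_inner_left) (auto simp: loc_integrable_def set_integrable_def)
  then show "set_integrable lborel (K \<inter> Q) (\<lambda>z. V z \<bullet> b)"
    by (simp add: set_integrable_def)
qed

lemma inner_grad_x: "v \<bullet> grad_x \<phi> z = (\<Sum>b\<in>Basis. (v \<bullet> b) * dx b \<phi> z)"
  by (simp add: grad_x_def inner_sum_right mult.commute)

lemma grad_x_measurable:
  assumes "test_fun UNIV \<phi>"
  shows "grad_x \<phi> \<in> borel_measurable borel"
proof -
  have [measurable]: "dx b \<phi> \<in> borel_measurable borel" for b
    by (rule test_fun_measurable[OF test_fun_dx[OF assms]])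
  show ?thesis unfolding grad_x_def[abs_def] by measurable
qed

lemma set_integral_inner_grad_x:
  fixes V :: "'a::euclidean_space \<times> real \<Rightarrow> 'a"
  assumes "loc_integrable V" "test_fun UNIV \<phi>"
  shows "set_integrable lborel Q (\<lambda>z. V z \<bullet> grad_x \<phi> z)"
    and "(LINT z:Q|lborel. V z \<bullet> grad_x \<phi> z) = (\<Sum>b\<in>Basis. LINT z:Q|lborel. (V z \<bullet> b) * dx b \<phi> z)"
proof -
  have i: "set_integrable lborel Q (\<lambda>z. (V z \<bullet> b) * dx b \<phi> z)" for b
    by (intro loc_integrable_test_fun loc_integrable_inner test_fun_dx assms)
  show "set_integrable lborel Q (\<lambda>z. V z \<bullet> grad_x \<phi> z)"
    using i unfolding inner_grad_x set_integrable_def scaleR_sum_right by (intro Bochner_Integration.integrable_sum)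
  show "(LINT z:Q|lborel. V z \<bullet> grad_x \<phi> z) = (\<Sum>b\<in>Basis. LINT z:Q|lborel. (V z \<bullet> b) * dx b \<phi> z)"
    using i unfolding inner_grad_x set_integrable_def set_lebesgue_integral_def scaleR_sum_right
    by (intro Bochner_Integration.integral_sum)
qed

lemma loc_integrable_sqrt_scaleR:
  fixes \<xi> :: "'a::euclidean_space \<times> real \<Rightarrow> 'a"
  assumes u: "loc_integrable u" and [measurable]: "\<xi> \<in> borel_measurable borel"
    and \<xi>: "set_integrable lborel Q (\<lambda>z. (norm (\<xi> z))\<^sup>2)"
  shows "loc_integrable (\<lambda>z. sqrt (u z) *\<^sub>R \<xi> z)"
  unfolding loc_integrable_def
proof (intro conjI allI impI)
  have [measurable]: "u \<in> borel_measurable borel"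
    using u by (auto simp: loc_integrable_def)
  show "(\<lambda>z. sqrt (u z) *\<^sub>R \<xi> z) \<in> borel_measurable borel"
    by measurable
  fix K :: "('a \<times> real) set" assume K: "compact K"
  then have [measurable]: "K \<in> sets borel" by (simp add: borel_compact)
  have "integrable lborel (\<lambda>z. norm (indicator (K \<inter> Q) z *\<^sub>R u z) + indicator Q z *\<^sub>R (norm (\<xi> z))\<^sup>2)"
    using u \<xi> K by (intro Bochner_Integration.integrable_add integrable_norm)
      (auto simp: loc_integrable_def set_integrable_def)
  then show "set_integrable lborel (K \<inter> Q) (\<lambda>z. sqrt (u z) *\<^sub>R \<xi> z)"
    unfolding set_integrable_def
  proof (rule Bochner_Integration.integrable_bound)
    \<comment> \<open>Young's inequality: local integrability of u and square integrability of \<xi>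
      control the product. As \<open>sqrt\<close> is odd on the reals, |sqrt a|^2 = |a| for either
      sign of a, and the estimate holds at every point.\<close>
    have "\<bar>sqrt a\<bar> * c \<le> \<bar>a\<bar> + c\<^sup>2" if "0 \<le> c" for a c :: real
    proof -
      have "0 \<le> (\<bar>sqrt a\<bar> - c)\<^sup>2 + \<bar>sqrt a\<bar>\<^sup>2 + c\<^sup>2" by simp
      then show ?thesis by (simp add: power2_eq_square algebra_simps flip: abs_mult)
    qed
    then have "norm (indicator (K \<inter> Q) z *\<^sub>R (sqrt (u z) *\<^sub>R \<xi> z))
      \<le> norm (norm (indicator (K \<inter> Q) z *\<^sub>R u z) + indicator Q z *\<^sub>R (norm (\<xi> z))\<^sup>2)" for z
      by (auto simp: indicator_def)
    then show "AE z in lborel. norm (indicator (K \<inter> Q) z *\<^sub>R (sqrt (u z) *\<^sub>R \<xi> z))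
      \<le> norm (norm (indicator (K \<inter> Q) z *\<^sub>R u z) + indicator Q z *\<^sub>R (norm (\<xi> z))\<^sup>2)" by simp
  qed measurable
qed


section \<open>The weak equation in flux form\<close>

lemma dx_mult_time:
  assumes f: "\<forall>k. C_k k f" and g: "\<forall>k. C_k k (g :: real \<Rightarrow> real)"
  shows "dx b (\<lambda>z. f z * g (snd z)) z = dx b f z * g (snd z)"
proof -
  have "((\<lambda>z. f z * g (snd z)) has_derivative
      (\<lambda>h. f z * frechet_derivative g (at (snd z)) (snd h) + frechet_derivative f (at z) h * g (snd z))) (at z)"
    by (intro has_derivative_mult smooth_has_derivative[OF f]
        has_derivative_compose[OF has_derivative_snd[OF has_derivative_ident] smooth_has_derivative[OF g]])
  from frechet_derivative_at[OF this, symmetric]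
  show ?thesis
    using linear_0[OF has_derivative_linear[OF smooth_has_derivative[OF g]]]
    by (simp add: dx_def)
qed

text \<open>Cut off near \<open>t = 0\<close> by a function of time only, which commutes with \<open>dx b\<close>.\<close>

lemma weak_grad_x_initial:
  fixes f :: "'a::euclidean_space \<times> real \<Rightarrow> real"
  assumes wg: "weak_grad_x f G" and \<phi>: "test_fun UNIV \<phi>" and b: "b \<in> Basis"
  shows "(LINT z:Q|lborel. f z * dx b \<phi> z) = - (LINT z:Q|lborel. (G z \<bullet> b) * \<phi> z)"
proof -
  \<comment> \<open>The cutoff vanishes for t \<le> 1/(n+1) and is 1 for t \<ge> 2/(n+1); hence the
    threshold 2 in the choice of N. The support of \<phi> times the cutoff stays at distance 1/(n+1)
    from t = 0, which makes the product admissible in \<open>weak_grad_x\<close>.\<close>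
  define \<rho> where "\<rho> n z = step (real (Suc n) * snd z + (- 1))" for n and z :: "'a \<times> real"
  have sm: "\<forall>k. C_k k (\<lambda>t. step (real (Suc n) * t + (- 1)))" for n
    by (intro allI C_k_step_affine)
  have [measurable]: "\<rho> n \<in> borel_measurable borel" for n
  proof -
    have "continuous_on UNIV (\<lambda>z. step (real (Suc n) * snd z + (- 1)))"
      by (rule continuous_on_compose2[OF smooth_continuous[OF smooth_step, of UNIV]])
         (auto intro!: continuous_intros)
    then show ?thesis unfolding \<rho>_def[abs_def] by (rule borel_measurable_continuous_onI)
  qed
  have \<rho>_bounds: "0 \<le> \<rho> n z" "\<rho> n z \<le> 1" for n z
    by (auto simp: \<rho>_def step_bounds)
  have \<rho>_lim: "(\<lambda>n. \<rho> n z) \<longlonglongrightarrow> 1" if "z \<in> Q" for z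
  proof -
    have t: "0 < snd z" using that by (auto simp: Q_def)
    obtain N where N: "2 < real N * snd z"
      using reals_Archimedean3[OF t] by blast
    have "\<rho> n z = 1" if "N \<le> n" for n
    proof -
      have "real N * snd z \<le> real (Suc n) * snd z"
        using that t by (intro mult_right_mono) auto
      then show ?thesis using N by (simp add: \<rho>_def step_eq_1)
    qed
    then show ?thesis
      by (intro tendsto_eventually) (auto simp: eventually_sequentially)
  qed
  have lim: "(\<lambda>n. LINT z:Q|lborel. h z * \<rho> n z) \<longlonglongrightarrow> (LINT z:Q|lborel. h z)"
    if h: "set_integrable lborel Q h" "h \<in> borel_measurable borel" for h :: "'a \<times> real \<Rightarrow> real"
    unfolding set_lebesgue_integral_def
  proof (rule integral_dominated_convergence)
    show "integrable lborel (\<lambda>z. norm (indicator Q z *\<^sub>R h z))"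
      using h by (intro integrable_norm) (auto simp: set_integrable_def)
    show "AE z in lborel. (\<lambda>n. indicator Q z *\<^sub>R (h z * \<rho> n z)) \<longlonglongrightarrow> indicator Q z *\<^sub>R h z"
    proof (rule AE_I2)
      fix z show "(\<lambda>n. indicator Q z *\<^sub>R (h z * \<rho> n z)) \<longlonglongrightarrow> indicator Q z *\<^sub>R h z"
        using tendsto_mult[OF tendsto_const \<rho>_lim, of z "h z"]
        by (cases "z \<in> Q") auto
    qed
    show "AE z in lborel. norm (indicator Q z *\<^sub>R (h z * \<rho> n z)) \<le> norm (indicator Q z *\<^sub>R h z)" for n
      using \<rho>_bounds by (auto simp: indicator_def abs_mult intro!: mult_left_le)
  qed (use h in measurable)
  have eq: "(LINT z:Q|lborel. f z * dx b \<phi> z * \<rho> n z) = - (LINT z:Q|lborel. (G z \<bullet> b) * \<phi> z * \<rho> n z)" for n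
  proof -
    let ?K = "closure {z. \<phi> z \<noteq> 0} \<inter> {z. 1 / real (Suc n) \<le> snd z}"
    have "test_fun Q (\<lambda>z. \<phi> z * \<rho> n z)"
    proof (rule test_funI)
      show "\<forall>k. C_k k (\<lambda>z. \<phi> z * \<rho> n z)"
        unfolding \<rho>_def using test_fun_smooth[OF \<phi>] sm[of n]
        by (intro allI C_k_mult C_k_compose_affine[where l = snd and g = snd])
           (auto intro!: derivative_eq_intros)
      show "compact ?K"
        using \<phi> by (intro compact_Int_closed closed_Collect_le) (auto simp: test_fun_def intro!: continuous_intros)
      show "{z. \<phi> z * \<rho> n z \<noteq> 0} \<subseteq> ?K"
      proof
        fix z assume "z \<in> {z. \<phi> z * \<rho> n z \<noteq> 0}"
        then have z: "\<phi> z \<noteq> 0" "\<rho> n z \<noteq> 0" by auto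
        then have "\<not> real (Suc n) * snd z + (- 1) \<le> 0"
          unfolding \<rho>_def using step_eq_0 by blast
        then have "1 / real (Suc n) \<le> snd z" by (simp add: field_simps)
        then show "z \<in> ?K" using z closure_subset by fastforce
      qed
      show "?K \<subseteq> Q"
      proof
        fix z assume "z \<in> ?K"
        then have "1 / real (Suc n) \<le> snd z" by simp
        moreover have "0 < 1 / real (Suc n)" by simp
        ultimately have "0 < snd z" by linarith
        then show "z \<in> Q" by (auto simp: Q_def mem_Times_iff)
      qed
    qed
    then have "(LINT z:Q|lborel. f z * dx b (\<lambda>z. \<phi> z * \<rho> n z) z) = - (LINT z:Q|lborel. (G z \<bullet> b) * (\<phi> z * \<rho> n z))"
      using wg b by (simp add: weak_grad_x_def)
    moreover have "dx b (\<lambda>z. \<phi> z * \<rho> n z) z = dx b \<phi> z * \<rho> n z" for z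
      unfolding \<rho>_def by (rule dx_mult_time[OF test_fun_smooth[OF \<phi>] sm])
    ultimately show ?thesis by (simp add: mult.assoc)
  qed
  have f: "loc_integrable f" and G: "loc_integrable (\<lambda>z. G z \<bullet> b)"
    using wg loc_integrable_inner by (auto simp: weak_grad_x_def)
  have [measurable]: "f \<in> borel_measurable borel" "(\<lambda>z. G z \<bullet> b) \<in> borel_measurable borel"
    "dx b \<phi> \<in> borel_measurable borel" "\<phi> \<in> borel_measurable borel"
    using f G test_fun_measurable[OF \<phi>] test_fun_measurable[OF test_fun_dx[OF \<phi>]]
    by (auto simp: loc_integrable_def)
  have "(\<lambda>n. LINT z:Q|lborel. f z * dx b \<phi> z * \<rho> n z) \<longlonglongrightarrow> (LINT z:Q|lborel. f z * dx b \<phi> z)"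
    by (intro lim loc_integrable_test_fun f test_fun_dx \<phi>) measurable
  moreover have "(\<lambda>n. - (LINT z:Q|lborel. (G z \<bullet> b) * \<phi> z * \<rho> n z)) \<longlonglongrightarrow> - (LINT z:Q|lborel. (G z \<bullet> b) * \<phi> z)"
    by (intro tendsto_minus lim loc_integrable_test_fun G \<phi>) measurable
  ultimately show ?thesis
    unfolding eq using LIMSEQ_unique by blast
qed

text \<open>Since \<open>dx b \<phi>\<close> is again a test function, one derivative of the
  Laplacian can be moved onto u p, where it produces \<open>G\<close>. Together with the term in p
  Du this leaves (G - p Du) paired with the gradient of \<phi>, and that field is sqrt u \<xi>
  almost everywhere.\<close>

lemma weak_solution_flux:
  fixes u p :: "'a::euclidean_space \<times> real \<Rightarrow> real"
  assumes ws: "weak_solution s u0 u p Du"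
    and \<xi>_meas: "\<xi> \<in> borel_measurable borel"
    and \<xi>: "set_integrable lborel Q (\<lambda>z. (norm (\<xi> z))\<^sup>2)"
    and wg: "weak_grad_x (\<lambda>z. u z * p z) G"
    and flux: "AE z in lborel. z \<in> Q \<longrightarrow> G z - p z *\<^sub>R Du z = sqrt (u z) *\<^sub>R \<xi> z"
    and \<phi>: "test_fun UNIV \<phi>"
  shows "(LINT z:Q|lborel. sqrt (u z) * (\<xi> z \<bullet> grad_x \<phi> z)) - (LINT z:Q|lborel. u z * dt \<phi> z)
      = (LINT x|lborel. u0 x * \<phi> (x, 0))"
proof -
  let ?W = "\<lambda>z. sqrt (u z) *\<^sub>R \<xi> z"
  have u: "loc_integrable u" and Du: "loc_integrable Du" and p: "p \<in> borel_measurable borel"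
    using ws by (auto simp: weak_solution_def weak_grad_x_def L2_sobolev_def)
  have W: "loc_integrable ?W" by (rule loc_integrable_sqrt_scaleR[OF u \<xi>_meas \<xi>])
  have G: "loc_integrable G" and up: "loc_integrable (\<lambda>z. u z * p z)"
    using wg by (auto simp: weak_grad_x_def)
  have [measurable]: "G \<in> borel_measurable borel" "Du \<in> borel_measurable borel"
      "p \<in> borel_measurable borel" "u \<in> borel_measurable borel" "\<xi> \<in> borel_measurable borel"
      "grad_x \<phi> \<in> borel_measurable borel"
    using u Du p \<xi>_meas G grad_x_measurable[OF \<phi>] by (auto simp: loc_integrable_def)
  have dxdx: "test_fun UNIV (dx b (dx b \<phi>))" for b by (intro test_fun_dx \<phi>)
  have "(LINT z:Q|lborel. p z * u z * laplace_x \<phi> z)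
      = (\<Sum>b\<in>Basis. LINT z:Q|lborel. u z * p z * dx b (dx b \<phi>) z)"
    using loc_integrable_test_fun[OF up dxdx]
    unfolding laplace_x_def set_integrable_def set_lebesgue_integral_def sum_distrib_left scaleR_sum_right
    by (subst Bochner_Integration.integral_sum[symmetric]) (auto simp: mult.commute)
  also have "\<dots> = - (\<Sum>b\<in>Basis. LINT z:Q|lborel. (G z \<bullet> b) * dx b \<phi> z)"
    using weak_grad_x_initial[OF wg test_fun_dx[OF \<phi>]] by (simp add: sum_negf)
  also have "\<dots> = - (LINT z:Q|lborel. G z \<bullet> grad_x \<phi> z)"
    by (simp add: set_integral_inner_grad_x(2)[OF G \<phi>])
  finally have lap: "(LINT z:Q|lborel. p z * u z * laplace_x \<phi> z) = - (LINT z:Q|lborel. G z \<bullet> grad_x \<phi> z)" .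
  \<comment> \<open>Writing p Du as the difference of the two locally integrable fields
    \<open>G\<close> and \<open>?W\<close> permits splitting the integral.\<close>
  have "(LINT z:Q|lborel. p z * (Du z \<bullet> grad_x \<phi> z))
      = (LINT z:Q|lborel. G z \<bullet> grad_x \<phi> z - ?W z \<bullet> grad_x \<phi> z)"
  proof (rule set_lebesgue_integral_cong_AE)
    show "AE z\<in>Q in lborel. p z * (Du z \<bullet> grad_x \<phi> z) = G z \<bullet> grad_x \<phi> z - ?W z \<bullet> grad_x \<phi> z"
      using flux
    proof eventually_elim
      case (elim z)
      have "p z * (Du z \<bullet> grad_x \<phi> z) = (G z - (G z - p z *\<^sub>R Du z)) \<bullet> grad_x \<phi> z" by simp
      with elim show ?case by (metis inner_diff_left)
    qed
  qed measurable
  also have "\<dots> = (LINT z:Q|lborel. G z \<bullet> grad_x \<phi> z) - (LINT z:Q|lborel. ?W z \<bullet> grad_x \<phi> z)"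
    by (intro set_integral_diff set_integral_inner_grad_x G W \<phi>)
  finally show ?thesis
    using ws \<phi> lap by (auto simp: weak_solution_def)
qed


section \<open>Spatial weights and temporal cutoffs\<close>

lemma smooth_has_real_derivative:
  fixes f :: "real \<Rightarrow> real"
  assumes "\<forall>k. C_k k f"
  shows "(f has_real_derivative frechet_derivative f (at x) 1) (at x)"
proof -
  have D: "(f has_derivative frechet_derivative f (at x)) (at x)"
    by (rule smooth_has_derivative[OF assms])
  have "frechet_derivative f (at x) h = frechet_derivative f (at x) 1 * h" for h
    using linear_scale[OF has_derivative_linear[OF D], of h 1] by (simp add: mult.commute)
  then show ?thesis
    unfolding has_field_derivative_def by (intro has_derivative_eq_rhs[OF D] ext)
qed

text \<open>The identity on [-1, 1], smoothly cut off outside [-2, 2]. The cutoff is two-sided so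
  that this is a test function on the line; its derivative is then bounded, and that bound is the
  constant \<open>L\<close> below.\<close>

definition profile :: "real \<Rightarrow> real" where
  "profile r = r * (step (- 1 * r + 2) * step (1 * r + 2))"

lemma test_fun_profile: "test_fun UNIV profile"
proof (rule test_funI)
  show "\<forall>k. C_k k profile"
    unfolding profile_def[abs_def]
    by (intro allI C_k_mult C_k_step_affine C_k_bounded_linear bounded_linear_ident)
  show "{r. profile r \<noteq> 0} \<subseteq> {-2..2}"
  proof
    fix r assume "r \<in> {r. profile r \<noteq> 0}"
    then have "\<not> - 1 * r + 2 \<le> 0" "\<not> 1 * r + 2 \<le> 0"
      using step_eq_0[of "- 1 * r + 2"] step_eq_0[of "1 * r + 2"] by (auto simp: profile_def)
    then show "r \<in> {-2..2}" by auto
  qed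
qed auto

lemma profile_eq: "0 \<le> r \<Longrightarrow> profile r = r * step (2 - r)"
  by (simp add: profile_def step_eq_1 add.commute)

text \<open>The Japanese bracket, a smooth substitute for |x| that lies between |x| and 1 +
  |x|.\<close>

definition bracket :: "'a::real_inner \<Rightarrow> real" where
  "bracket x = sqrt (1 + x \<bullet> x)"

lemma bracket_bounds: "1 \<le> bracket x" "norm x \<le> bracket x" "bracket x \<le> 1 + norm x"
proof -
  show "1 \<le> bracket x" by (simp add: bracket_def)
  show "norm x \<le> bracket x"
    unfolding bracket_def norm_eq_sqrt_inner by (rule real_sqrt_le_mono) simp
  show "bracket x \<le> 1 + norm x"
    unfolding bracket_def
    by (rule real_le_lsqrt) (auto simp: power2_norm_eq_inner[symmetric] power2_eq_square algebra_simps)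
qed

lemma bracket_has_derivative: "(bracket has_derivative (\<lambda>v. (x \<bullet> v) / bracket x)) (at x)"
proof -
  have "((\<lambda>x. sqrt (1 + x \<bullet> x)) has_derivative (\<lambda>v. (x \<bullet> v + v \<bullet> x) * inverse (sqrt (1 + x \<bullet> x)) / 2)) (at x)"
    by (rule has_derivative_eq_rhs[OF has_derivative_real_sqrt[OF _ has_derivative_add[OF has_derivative_const
         has_derivative_inner[OF has_derivative_ident has_derivative_ident]]]])
       (auto simp: add_pos_nonneg field_simps)
  then show ?thesis
    unfolding bracket_def[abs_def] by (rule has_derivative_eq_rhs) (auto simp: inner_commute field_simps)
qed

lemma C_k_bracket: "C_k k (bracket :: 'a::real_inner \<Rightarrow> real)"
proof -
  have "C_k k (\<lambda>x::'a. x \<bullet> x)"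
  proof (cases k)
    case 0
    then show ?thesis by (auto intro: continuous_intros)
  next
    case (Suc j)
    show ?thesis unfolding Suc
    proof (rule C_k_SucI)
      show "((\<lambda>x::'a. x \<bullet> x) has_derivative (\<lambda>v. x \<bullet> v + v \<bullet> x)) (at x)" for x
        by (rule has_derivative_inner[OF has_derivative_ident has_derivative_ident])
      show "C_k j (\<lambda>x. x \<bullet> v + v \<bullet> x)" for v :: 'a
        by (intro C_k_add C_k_bounded_linear bounded_linear_inner_left bounded_linear_inner_right)
    qed
  qed
  then show ?thesis
    unfolding bracket_def[abs_def]
    by (intro C_k_sqrt C_k_add C_k_const) (auto simp: add_pos_nonneg)
qed

text \<open>The functions \<open>n * profile (bracket x / n)\<close> have gradients bounded independently of \<open>n\<close>.\<close>

lemma spatial_weights: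
  obtains \<psi> :: "nat \<Rightarrow> 'a::euclidean_space \<Rightarrow> real" and L
  where "0 \<le> L" "\<And>n. test_fun UNIV (\<psi> n)" "\<And>n x. 0 \<le> \<psi> n x" "\<And>n x. \<psi> n x \<le> 1 + norm x"
    "\<And>n x b. b \<in> Basis \<Longrightarrow> \<bar>frechet_derivative (\<psi> n) (at x) b\<bar> \<le> L"
    "\<And>x. \<forall>\<^sub>F n in sequentially. norm x \<le> \<psi> n x"
proof -
  let ?D = "\<lambda>r. frechet_derivative profile (at r) 1"
  obtain L where L: "\<And>r. \<bar>?D r\<bar> \<le> L"
    using test_fun_bounded[OF test_fun_frechet[OF test_fun_profile, of 1]] by metis
  define \<psi> :: "nat \<Rightarrow> 'a \<Rightarrow> real"
    where "\<psi> n x = real (Suc n) * profile (inverse (real (Suc n)) * bracket x)" for n x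
  have arg: "0 \<le> inverse (real (Suc n)) * bracket x" for n and x :: 'a
    using bracket_bounds(1)[of x] by simp
  have \<psi>_eq: "\<psi> n x = bracket x * step (2 - inverse (real (Suc n)) * bracket x)" for n x
    unfolding \<psi>_def profile_eq[OF arg] by simp
  show ?thesis
  proof (rule that)
    show "0 \<le> L" using L[of 0] by linarith
    show "0 \<le> \<psi> n x" for n x
      using bracket_bounds(1)[of x] step_bounds by (simp add: \<psi>_eq)
    have "\<psi> n x \<le> bracket x" for n x
      unfolding \<psi>_eq using bracket_bounds(1)[of x] step_bounds by (intro mult_left_le) auto
    then show "\<psi> n x \<le> 1 + norm x" for n x
      using bracket_bounds(3) order_trans by blast
    show "test_fun UNIV (\<psi> n)" for n
    proof (rule test_funI)
      show "\<forall>k. C_k k (\<psi> n)"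
        unfolding \<psi>_def[abs_def]
        by (intro allI C_k_mult[OF C_k_const C_k_compose[OF spec[OF test_fun_smooth[OF test_fun_profile]]
              C_k_mult[OF C_k_const C_k_bracket]]])
      show "{x. \<psi> n x \<noteq> 0} \<subseteq> cball 0 (2 * real (Suc n))"
      proof
        fix x assume "x \<in> {x. \<psi> n x \<noteq> 0}"
        then have "\<not> 2 - inverse (real (Suc n)) * bracket x \<le> 0"
          using step_eq_0 by (auto simp: \<psi>_eq)
        then have "bracket x \<le> 2 * real (Suc n)" by (simp add: field_simps)
        then show "x \<in> cball 0 (2 * real (Suc n))"
          using bracket_bounds(2)[of x] by simp
      qed
    qed auto
    show "\<bar>frechet_derivative (\<psi> n) (at x) b\<bar> \<le> L" if "b \<in> Basis" for n x b
    proof -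
      let ?c = "real (Suc n)" and ?r = "inverse (real (Suc n)) * bracket x"
      have p: "(profile has_real_derivative ?D ?r) (at ?r)"
        by (rule smooth_has_real_derivative[OF test_fun_smooth[OF test_fun_profile]])
      \<comment> \<open>The outer factor n+1 cancels the inner factor 1/(n+1), and the gradient of
        \<open>bracket\<close> has length at most 1; what remains is bounded by the bound for the
        derivative of \<open>profile\<close>.\<close>
      have "(\<psi> n has_derivative (\<lambda>v. ?c * (inverse ?c * ((x \<bullet> v) / bracket x) * ?D ?r))) (at x)"
        unfolding \<psi>_def[abs_def]
        by (rule has_derivative_mult_right[OF
              has_derivative_eq_rhs[OF has_derivative_compose[OF has_derivative_mult_right[OF bracket_has_derivative]
                p[unfolded has_field_derivative_def]]]]) (simp add: fun_eq_iff)
      from frechet_derivative_at[OF this, symmetric]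
      have "\<bar>frechet_derivative (\<psi> n) (at x) b\<bar> = \<bar>x \<bullet> b\<bar> / bracket x * \<bar>?D ?r\<bar>"
        using bracket_bounds(1)[of x] by (simp add: abs_mult)
      also have "\<dots> \<le> 1 * L"
      proof (intro mult_mono L)
        have "\<bar>x \<bullet> b\<bar> \<le> bracket x"
          using Basis_le_norm[OF that, of x] bracket_bounds(2)[of x] by linarith
        then show "\<bar>x \<bullet> b\<bar> / bracket x \<le> 1"
          using bracket_bounds(1)[of x] by (simp add: field_simps)
      qed auto
      finally show ?thesis by simp
    qed
    show "\<forall>\<^sub>F n in sequentially. norm x \<le> \<psi> n x" for x
    proof -
      obtain N :: nat where N: "bracket x \<le> real N" using real_arch_simple by blast
      have "norm x \<le> \<psi> n x" if "N \<le> n" for n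
      proof -
        have "bracket x \<le> real (Suc n)" using N that by simp
        then have "1 \<le> 2 - inverse (real (Suc n)) * bracket x" by (simp add: field_simps)
        then show ?thesis using bracket_bounds(2)[of x] by (simp add: \<psi>_eq step_eq_1)
      qed
      then show ?thesis by (auto simp: eventually_sequentially)
    qed
  qed
qed

text \<open>On t \<ge> 0, \<theta> t is the integral of \<kappa> over (t, \<infinity>). Testing the
  equation with \<psi> \<theta> thus turns the time derivative term into the \<kappa>-weighted time
  average of the integral of \<psi> u, while \<theta> 0, the total weight, multiplies the initial
  datum and dominates the flux term.\<close>

lemma temporal_cutoff:
  fixes a b :: real
  assumes ab: "0 \<le> a" "a < b" and sm: "\<forall>k. C_k k \<kappa>"
    and \<kappa>: "\<And>t. 0 \<le> \<kappa> t" "\<And>t. \<kappa> t \<le> 1" and supp: "\<And>t. t \<notin> {a..b} \<Longrightarrow> \<kappa> t = 0"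
  obtains \<theta> where "test_fun UNIV \<theta>" "\<theta> 0 \<le> b - a" "\<And>t. 0 \<le> t \<Longrightarrow> 0 \<le> \<theta> t \<and> \<theta> t \<le> \<theta> 0"
    "\<And>t. b \<le> t \<Longrightarrow> \<theta> t = 0" "\<And>t. 0 < t \<Longrightarrow> frechet_derivative \<theta> (at t) 1 = - \<kappa> t"
proof -
  have "\<exists>K. \<forall>t. -\<infinity> < ereal t \<longrightarrow> ereal t < \<infinity> \<longrightarrow> (K has_vector_derivative \<kappa> t) (at t)"
    by (rule einterval_antiderivative)
       (use smooth_continuous[OF sm, of UNIV] in \<open>auto simp: continuous_on_eq_continuous_at\<close>)
  then obtain K where K: "\<And>t. (K has_real_derivative \<kappa> t) (at t)"
    by (auto simp: has_real_derivative_iff_has_vector_derivative)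
  have mvt: "\<exists>z. s < z \<and> z < t \<and> K t - K s = (t - s) * \<kappa> z" if "s < t" for s t
    by (rule MVT2[OF that K])
  have mono: "K s \<le> K t" if "s \<le> t" for s t
    using that K \<kappa>(1) by (intro DERIV_nonneg_imp_nondecreasing[of s t K]) auto
  have right: "K t = K b" if "b \<le> t" for t
  proof (cases "b = t")
    case False
    then obtain z where "b < z" "K t - K b = (t - b) * \<kappa> z" using mvt[of b t] \<open>b \<le> t\<close> by auto
    then show ?thesis using supp[of z] by simp
  qed simp
  have left: "K 0 = K a"
  proof (cases "a = 0")
    case False
    then obtain z where "z < a" "K a - K 0 = (a - 0) * \<kappa> z" using mvt[of 0 a] ab by auto
    then show ?thesis using supp[of z] by simp
  qed simp
  have ba: "K b - K a \<le> b - a"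
  proof -
    obtain z where "K b - K a = (b - a) * \<kappa> z" using mvt[OF ab(2)] by auto
    then show ?thesis using \<kappa>[of z] ab by (simp add: mult_left_le)
  qed
  \<comment> \<open>For t \<le> 0 the difference \<open>K b - K t\<close> is constant and in general
    nonzero, so it must be truncated to get compact support. The factor is 1 for t \<ge> -1, which
    leaves the values and derivatives at t \<ge> 0 untouched.\<close>
  define \<theta> where "\<theta> t = (K b - K t) * step (1 * t + 2)" for t
  have \<theta>_eq: "\<theta> t = K b - K t" if "-1 \<le> t" for t
    using that by (simp add: \<theta>_def step_eq_1)
  show ?thesis
  proof (rule that)
    show "test_fun UNIV \<theta>"
    proof (rule test_funI)
      show "\<forall>k. C_k k \<theta>"
        unfolding \<theta>_def[abs_def] using smooth_antiderivative[OF sm K]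
        by (intro allI C_k_mult C_k_diff C_k_const C_k_step_affine) auto
      show "{t. \<theta> t \<noteq> 0} \<subseteq> {-2..b}"
      proof
        fix t assume t: "t \<in> {t. \<theta> t \<noteq> 0}"
        then have "\<not> 1 * t + 2 \<le> 0" "\<not> b \<le> t"
          using step_eq_0[of "1 * t + 2"] right[of t] by (auto simp: \<theta>_def)
        then show "t \<in> {-2..b}" by auto
      qed
    qed auto
    show "\<theta> 0 \<le> b - a" using ba left by (simp add: \<theta>_eq)
    show "0 \<le> \<theta> t \<and> \<theta> t \<le> \<theta> 0" if "0 \<le> t" for t
      using that mono[of 0 t] mono[of t b] right[of t] by (cases "t \<le> b") (auto simp: \<theta>_eq)
    show "\<theta> t = 0" if "b \<le> t" for t
      using right[OF that] by (simp add: \<theta>_def)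
    show "frechet_derivative \<theta> (at t) 1 = - \<kappa> t" if "0 < t" for t
    proof -
      have "((\<lambda>t. K b - K t) has_derivative (\<lambda>h. - (\<kappa> t * h))) (at t)"
        using K[of t] by (auto simp: has_field_derivative_def intro!: derivative_eq_intros)
      then have "(\<theta> has_derivative (\<lambda>h. - (\<kappa> t * h))) (at t)"
        by (rule has_derivative_transform_within_open[where s = "{-1<..}"])
           (use that in \<open>auto simp: \<theta>_eq\<close>)
      from frechet_derivative_at[OF this, symmetric] show ?thesis by simp
    qed
  qed
qed


section \<open>Weighted mass estimates\<close>

text \<open>A chosen fractional Laplacian is in L^2 by \<open>has_fourier\<close>, and the default
  value is 0. This makes the right-hand side of the energy estimate finite.\<close>

lemma frac_lap_square_integrable:
  "(\<integral>\<^sup>+x. ennreal ((frac_lap \<sigma> f x)\<^sup>2) \<partial>lborel) < \<infinity>"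
proof (cases "\<exists>g. is_frac_lap \<sigma> f g")
  case True
  then have "is_frac_lap \<sigma> f (frac_lap \<sigma> f)"
    unfolding frac_lap_def by (simp add: someI_ex)
  then have "integrable lborel (\<lambda>x. (frac_lap \<sigma> f x)\<^sup>2)"
    by (auto simp: is_frac_lap_def has_fourier_def L2_fun_def)
  then show ?thesis
    by (simp add: nn_integral_eq_integral)
qed (simp add: frac_lap_def)

section \<open>Tonelli's theorem and measurability of time slices\<close>

lemma nn_integral_slices:
  fixes f :: "'a::euclidean_space \<times> real \<Rightarrow> ennreal"
  assumes "f \<in> borel_measurable borel"
  shows "(\<integral>\<^sup>+z. f z \<partial>lborel) = (\<integral>\<^sup>+t. \<integral>\<^sup>+x. f (x, t) \<partial>lborel \<partial>lborel)"
proof -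
  have "f \<in> borel_measurable (lborel \<Otimes>\<^sub>M lborel)"
    unfolding lborel_prod using assms by simp
  from lborel_pair.nn_integral_snd[OF this] show ?thesis
    by (simp add: lborel_prod)
qed

lemma slice_measurable:
  fixes f :: "'a::euclidean_space \<times> real \<Rightarrow> 'b::topological_space"
  assumes "f \<in> borel_measurable borel"
  shows "(\<lambda>x. f (x, t)) \<in> borel_measurable borel"
  by (rule measurable_compose[OF _ assms])
     (intro borel_measurable_continuous_onI continuous_intros)

lemma nn_integral_slice_measurable:
  fixes f :: "'a::euclidean_space \<times> real \<Rightarrow> ennreal"
  assumes "f \<in> borel_measurable borel"
  shows "(\<lambda>t. \<integral>\<^sup>+x. f (x, t) \<partial>lborel) \<in> borel_measurable borel"
proof -
  have "f \<in> borel_measurable (lborel \<Otimes>\<^sub>M lborel)"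
    unfolding lborel_prod using assms by simp
  then have "(\<lambda>(t, x). f (x, t)) \<in> borel_measurable (lborel \<Otimes>\<^sub>M lborel)"
    by (subst measurable_pair_swap_iff) (simp add: case_prod_beta)
  from lborel.borel_measurable_nn_integral[OF this] show ?thesis by simp
qed

section \<open>Test functions that are products of a weight in space and a weight in time\<close>

lemma product_has_derivative:
  assumes "\<forall>k. C_k k \<psi>" "\<forall>k. C_k k (\<theta> :: real \<Rightarrow> real)"
  shows "((\<lambda>z. \<psi> (fst z) * \<theta> (snd z)) has_derivative
     (\<lambda>h. \<psi> (fst z) * frechet_derivative \<theta> (at (snd z)) (snd h)
        + frechet_derivative \<psi> (at (fst z)) (fst h) * \<theta> (snd z))) (at z)"
  by (intro has_derivative_mult has_derivative_compose[OF has_derivative_snd[OF has_derivative_ident]]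
      has_derivative_compose[OF has_derivative_fst[OF has_derivative_ident]] smooth_has_derivative assms)

lemma dx_product:
  assumes "\<forall>k. C_k k \<psi>" "\<forall>k. C_k k \<theta>"
  shows "dx b (\<lambda>z. \<psi> (fst z) * \<theta> (snd z)) z = frechet_derivative \<psi> (at (fst z)) b * \<theta> (snd z)"
  unfolding dx_def frechet_derivative_at[OF product_has_derivative[OF assms], symmetric]
  using linear_0[OF has_derivative_linear[OF smooth_has_derivative[OF assms(2)]]] by simp

lemma dt_product:
  assumes "\<forall>k. C_k k \<psi>" "\<forall>k. C_k k \<theta>"
  shows "dt (\<lambda>z. \<psi> (fst z) * \<theta> (snd z)) z = \<psi> (fst z) * frechet_derivative \<theta> (at (snd z)) 1"
  unfolding dt_def frechet_derivative_at[OF product_has_derivative[OF assms], symmetric]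
  using linear_0[OF has_derivative_linear[OF smooth_has_derivative[OF assms(1)]]] by simp

lemma test_fun_product:
  fixes \<psi> :: "'a::real_normed_vector \<Rightarrow> real" and \<theta> :: "real \<Rightarrow> real"
  assumes "test_fun UNIV \<psi>" "test_fun UNIV \<theta>"
  shows "test_fun UNIV (\<lambda>z. \<psi> (fst z) * \<theta> (snd z))"
proof (rule test_funI)
  let ?K = "closure {x. \<psi> x \<noteq> 0} \<times> closure {t. \<theta> t \<noteq> 0}"
  have "C_k k (\<lambda>z. \<psi> (fst z))" "C_k k (\<lambda>z. \<theta> (snd z))" for k
    using assms[THEN test_fun_smooth]
    by (auto intro: C_k_compose_affine[OF has_derivative_fst[OF has_derivative_ident]]
        C_k_compose_affine[OF has_derivative_snd[OF has_derivative_ident]])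
  then show "\<forall>k. C_k k (\<lambda>z. \<psi> (fst z) * \<theta> (snd z))"
    by (intro allI C_k_mult)
  show "compact ?K" using assms by (auto simp: test_fun_def intro: compact_Times)
  show "{z. \<psi> (fst z) * \<theta> (snd z) \<noteq> 0} \<subseteq> ?K"
    using closure_subset[of "{x. \<psi> x \<noteq> 0}"] closure_subset[of "{t. \<theta> t \<noteq> 0}"]
    by (auto simp: mem_Times_iff)
qed auto

section \<open>The flux term and the weighted mass on time intervals\<close>

text \<open>The factor \<open>DIM('a)\<close> comes from bounding each component of \<xi> by its
  norm and summing over the basis, the factor 1/2 from Young's inequality. \<open>late\<close>
  confines the integral to t \<le> T, where \<open>B\<close> applies.\<close>

lemma flux_bound:
  fixes u :: "'a::euclidean_space \<times> real \<Rightarrow> real" and \<xi> :: "'a \<times> real \<Rightarrow> 'a" and \<Lambda> :: real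
  assumes u: "loc_integrable u" and u_nonneg: "AE z in lborel. z \<in> Q \<longrightarrow> 0 \<le> u z"
    and \<xi>_meas: "\<xi> \<in> borel_measurable borel"
    and \<xi>: "set_integrable lborel Q (\<lambda>z. (norm (\<xi> z))\<^sup>2)"
    and B: "(\<integral>\<^sup>+t\<in>{0<..T}. (\<integral>\<^sup>+x. ennreal (u (x, t)) + ennreal ((norm (\<xi> (x, t)))\<^sup>2) \<partial>lborel) \<partial>lborel)
      \<le> ennreal B" "0 \<le> B"
    and \<phi>: "test_fun UNIV \<phi>"
    and \<Lambda>: "0 \<le> \<Lambda>" "\<And>b z. b \<in> Basis \<Longrightarrow> z \<in> Q \<Longrightarrow> \<bar>dx b \<phi> z\<bar> \<le> \<Lambda>"
    and late: "\<And>b z. b \<in> Basis \<Longrightarrow> T < snd z \<Longrightarrow> dx b \<phi> z = 0"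
  shows "\<bar>LINT z:Q|lborel. sqrt (u z) * (\<xi> z \<bullet> grad_x \<phi> z)\<bar> \<le> DIM('a) * \<Lambda> / 2 * B"
proof -
  let ?c = "DIM('a) * \<Lambda> / 2"
  let ?h = "\<lambda>z. (ennreal (u z) + ennreal ((norm (\<xi> z))\<^sup>2)) * indicator {0<..T} (snd z)"
  have [measurable]: "u \<in> borel_measurable borel" "\<xi> \<in> borel_measurable borel"
    using u \<xi>_meas by (auto simp: loc_integrable_def)
  have [measurable]: "snd \<in> borel_measurable (borel :: ('a \<times> real) measure)"
    by (intro borel_measurable_continuous_onI continuous_intros)
  have c: "0 \<le> ?c" using \<Lambda> by simp
  have "set_integrable lborel Q (\<lambda>z. (sqrt (u z) *\<^sub>R \<xi> z) \<bullet> grad_x \<phi> z)"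
    by (intro set_integral_inner_grad_x loc_integrable_sqrt_scaleR u \<xi>_meas \<xi> \<phi>)
  then have "integrable lborel (\<lambda>z. indicator Q z *\<^sub>R (sqrt (u z) * (\<xi> z \<bullet> grad_x \<phi> z)))"
    by (simp add: set_integrable_def)
  from integral_norm_bound_ennreal[OF this]
  have "ennreal \<bar>LINT z:Q|lborel. sqrt (u z) * (\<xi> z \<bullet> grad_x \<phi> z)\<bar>
      \<le> (\<integral>\<^sup>+z. ennreal (norm (indicator Q z *\<^sub>R (sqrt (u z) * (\<xi> z \<bullet> grad_x \<phi> z)))) \<partial>lborel)"
    by (simp add: set_lebesgue_integral_def)
  also have "\<dots> \<le> (\<integral>\<^sup>+z. ennreal ?c * ?h z \<partial>lborel)"
  proof (rule nn_integral_mono_AE)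
    show "AE z in lborel. ennreal (norm (indicator Q z *\<^sub>R (sqrt (u z) * (\<xi> z \<bullet> grad_x \<phi> z))))
        \<le> ennreal ?c * ?h z"
      using u_nonneg
    proof eventually_elim
      case (elim z)
      show ?case
      proof (cases "z \<in> Q \<and> snd z \<le> T")
        case True
        then have z: "z \<in> Q" "0 \<le> u z" "snd z \<in> {0<..T}" using elim by (auto simp: Q_def)
        have "\<bar>\<xi> z \<bullet> grad_x \<phi> z\<bar> \<le> (\<Sum>b\<in>Basis. \<bar>(\<xi> z \<bullet> b) * dx b \<phi> z\<bar>)"
          unfolding inner_grad_x by (rule sum_abs)
        also have "\<dots> \<le> (\<Sum>b\<in>(Basis::'a set). norm (\<xi> z) * \<Lambda>)"
          unfolding abs_mult using z \<Lambda> by (intro sum_mono mult_mono Basis_le_norm) auto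
        also have "\<dots> = DIM('a) * \<Lambda> * norm (\<xi> z)" by simp
        finally have 1: "\<bar>\<xi> z \<bullet> grad_x \<phi> z\<bar> \<le> DIM('a) * \<Lambda> * norm (\<xi> z)" .
        have "0 \<le> (sqrt (u z) - norm (\<xi> z))\<^sup>2" by simp
        then have 2: "sqrt (u z) * norm (\<xi> z) \<le> (u z + (norm (\<xi> z))\<^sup>2) / 2"
          using z by (simp add: power2_diff)
        have "\<bar>sqrt (u z) * (\<xi> z \<bullet> grad_x \<phi> z)\<bar> \<le> sqrt (u z) * (DIM('a) * \<Lambda> * norm (\<xi> z))"
          unfolding abs_mult using 1 z by (intro mult_mono) auto
        also have "\<dots> = DIM('a) * \<Lambda> * (sqrt (u z) * norm (\<xi> z))" by simp
        also have "\<dots> \<le> DIM('a) * \<Lambda> * ((u z + (norm (\<xi> z))\<^sup>2) / 2)"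
          using 2 \<Lambda> by (intro mult_left_mono) auto
        also have "\<dots> = ?c * (u z + (norm (\<xi> z))\<^sup>2)" by simp
        finally have "ennreal \<bar>sqrt (u z) * (\<xi> z \<bullet> grad_x \<phi> z)\<bar> \<le> ennreal (?c * (u z + (norm (\<xi> z))\<^sup>2))"
          by (rule ennreal_leI)
        also have "\<dots> = ennreal ?c * (ennreal (u z) + ennreal ((norm (\<xi> z))\<^sup>2))"
          unfolding ennreal_mult'[OF c] using z by (simp add: ennreal_plus)
        finally show ?thesis using z by simp
      next
        case False
        then have "z \<notin> Q \<or> \<xi> z \<bullet> grad_x \<phi> z = 0"
          unfolding inner_grad_x using late[of _ z] by (auto intro!: sum.neutral)
        then have "indicator Q z *\<^sub>R (sqrt (u z) * (\<xi> z \<bullet> grad_x \<phi> z)) = 0"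
          by auto
        from arg_cong[OF this, of norm] show ?thesis by (simp only: norm_zero ennreal_0 zero_le)
      qed
    qed
  qed
  also have "\<dots> = ennreal ?c * (\<integral>\<^sup>+z. ?h z \<partial>lborel)"
    by (rule nn_integral_cmult) measurable
  also have "(\<integral>\<^sup>+z. ?h z \<partial>lborel)
      = (\<integral>\<^sup>+t\<in>{0<..T}. (\<integral>\<^sup>+x. ennreal (u (x, t)) + ennreal ((norm (\<xi> (x, t)))\<^sup>2) \<partial>lborel) \<partial>lborel)"
  proof -
    have [measurable]: "(\<lambda>x. u (x, t)) \<in> borel_measurable borel" "(\<lambda>x. \<xi> (x, t)) \<in> borel_measurable borel" for t
      by (rule slice_measurable, measurable)+
    have "(\<integral>\<^sup>+z. ?h z \<partial>lborel) = (\<integral>\<^sup>+t. \<integral>\<^sup>+x. ?h (x, t) \<partial>lborel \<partial>lborel)"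
      by (rule nn_integral_slices) measurable
    also have "\<dots> = (\<integral>\<^sup>+t\<in>{0<..T}. (\<integral>\<^sup>+x. ennreal (u (x, t)) + ennreal ((norm (\<xi> (x, t)))\<^sup>2) \<partial>lborel) \<partial>lborel)"
      by (simp add: nn_integral_multc)
    finally show ?thesis .
  qed
  also have "ennreal ?c * \<dots> \<le> ennreal ?c * ennreal B"
    using B by (intro mult_left_mono) auto
  also have "\<dots> = ennreal (?c * B)"
    by (rule ennreal_mult'[OF c, symmetric])
  finally show ?thesis
    using c B by (subst (asm) ennreal_le_iff) auto
qed

text \<open>Test with \<psi> \<theta>, where \<theta> belongs to a smooth weight \<kappa> \<le> 1
  supported in the interval. The initial term is at most M \<theta> 0 and the flux term at most
  \<theta> 0 times a constant, and \<theta> 0 \<le> b - a yields the length of the interval as a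
  factor.\<close>

lemma weighted_interval_bound:
  fixes u :: "'a::euclidean_space \<times> real \<Rightarrow> real" and \<xi> :: "'a \<times> real \<Rightarrow> 'a"
    and L M :: real
  assumes ws: "weak_solution s u0 u p Du"
    and \<xi>_meas: "\<xi> \<in> borel_measurable borel"
    and \<xi>: "set_integrable lborel Q (\<lambda>z. (norm (\<xi> z))\<^sup>2)"
    and wg: "weak_grad_x (\<lambda>z. u z * p z) G"
    and flux: "AE z in lborel. z \<in> Q \<longrightarrow> G z - p z *\<^sub>R Du z = sqrt (u z) *\<^sub>R \<xi> z"
    and B: "(\<integral>\<^sup>+t\<in>{0<..T}. (\<integral>\<^sup>+x. ennreal (u (x, t)) + ennreal ((norm (\<xi> (x, t)))\<^sup>2) \<partial>lborel) \<partial>lborel)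
      \<le> ennreal B" "0 \<le> B"
    and \<psi>: "test_fun UNIV \<psi>" "\<And>x. 0 \<le> \<psi> x"
    and L: "0 \<le> L" "\<And>b x. b \<in> Basis \<Longrightarrow> \<bar>frechet_derivative \<psi> (at x) b\<bar> \<le> L"
    and M: "(LINT x|lborel. u0 x * \<psi> x) \<le> M" "0 \<le> M"
    and ab: "0 \<le> a" "a < b" "b \<le> T"
  shows "(\<integral>\<^sup>+t\<in>{a<..<b}. (\<integral>\<^sup>+x. ennreal (\<psi> x * u (x, t)) \<partial>lborel) \<partial>lborel)
      \<le> ennreal ((b - a) * (M + DIM('a) * L / 2 * B))"
proof -
  let ?A = "M + DIM('a) * L / 2 * B"
  define \<mu> where "\<mu> t = (\<integral>\<^sup>+x. ennreal (\<psi> x * u (x, t)) \<partial>lborel)" for t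
  have u: "loc_integrable u" and u_nonneg: "AE z in lborel. z \<in> Q \<longrightarrow> 0 \<le> u z"
    using ws by (auto simp: weak_solution_def weak_grad_x_def)
  have A: "0 \<le> ?A" using M L B by simp
  have [measurable]: "u \<in> borel_measurable borel" "\<psi> \<in> borel_measurable borel"
    using u test_fun_measurable[OF \<psi>(1)] by (auto simp: loc_integrable_def)
  have [measurable]: "fst \<in> borel_measurable (borel :: ('a \<times> real) measure)"
    "snd \<in> borel_measurable (borel :: ('a \<times> real) measure)"
    by (intro borel_measurable_continuous_onI continuous_intros)+
  have u_slice [measurable]: "(\<lambda>x. u (x, t)) \<in> borel_measurable borel" for t
    by (rule slice_measurable) measurable
  have \<mu>_meas [measurable]: "\<mu> \<in> borel_measurable borel"
    using nn_integral_slice_measurable[of "\<lambda>z. ennreal (\<psi> (fst z) * u z)"]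
    by (simp add: \<mu>_def[abs_def])
  have smooth_bound: "(\<integral>\<^sup>+t. ennreal (\<kappa> t) * \<mu> t \<partial>lborel) \<le> ennreal ((b - a) * ?A)"
    if sm: "\<forall>k. C_k k \<kappa>" and \<kappa>: "\<And>t. 0 \<le> \<kappa> t" "\<And>t. \<kappa> t \<le> 1" "\<And>t. t \<notin> {a<..<b} \<Longrightarrow> \<kappa> t = 0" for \<kappa>
  proof -
    obtain \<theta> where \<theta>: "test_fun UNIV \<theta>" "\<theta> 0 \<le> b - a" "\<And>t. 0 \<le> t \<Longrightarrow> 0 \<le> \<theta> t \<and> \<theta> t \<le> \<theta> 0"
      "\<And>t. b \<le> t \<Longrightarrow> \<theta> t = 0" "\<And>t. 0 < t \<Longrightarrow> frechet_derivative \<theta> (at t) 1 = - \<kappa> t"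
      using temporal_cutoff[OF ab(1,2) sm \<kappa>(1,2)] \<kappa>(3) by (metis atLeastAtMost_iff greaterThanLessThan_iff less_imp_le)
    have \<theta>0: "0 \<le> \<theta> 0" using \<theta>(3)[of 0] by simp
    define \<phi> where "\<phi> = (\<lambda>z. \<psi> (fst z) * \<theta> (snd z))"
    have \<phi>: "test_fun UNIV \<phi>" unfolding \<phi>_def by (rule test_fun_product[OF \<psi>(1) \<theta>(1)])
    have [measurable]: "\<kappa> \<in> borel_measurable borel"
      by (rule borel_measurable_continuous_onI[OF smooth_continuous[OF sm]])
    have dt: "dt \<phi> z = - (\<psi> (fst z) * \<kappa> (snd z))" if "z \<in> Q" for z
      using that \<theta>(5) unfolding \<phi>_def dt_product[OF test_fun_smooth[OF \<psi>(1)] test_fun_smooth[OF \<theta>(1)]]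
      by (auto simp: Q_def)
    have dx: "dx b \<phi> z = frechet_derivative \<psi> (at (fst z)) b * \<theta> (snd z)" for b z
      unfolding \<phi>_def by (rule dx_product[OF test_fun_smooth[OF \<psi>(1)] test_fun_smooth[OF \<theta>(1)]])
    have fl: "\<bar>LINT z:Q|lborel. sqrt (u z) * (\<xi> z \<bullet> grad_x \<phi> z)\<bar> \<le> DIM('a) * (L * \<theta> 0) / 2 * B"
    proof (rule flux_bound[OF u u_nonneg \<xi>_meas \<xi> B \<phi>])
      show "0 \<le> L * \<theta> 0" using L \<theta>0 by simp
      show "\<bar>dx b \<phi> z\<bar> \<le> L * \<theta> 0" if "b \<in> Basis" "z \<in> Q" for b z
        unfolding dx abs_mult using that L \<theta>(3)[of "snd z"] by (intro mult_mono) (auto simp: Q_def)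
      show "dx b \<phi> z = 0" if "T < snd z" for b z
        using that ab \<theta>(4)[of "snd z"] by (simp add: dx)
    qed
    have int: "set_integrable lborel Q (\<lambda>z. u z * dt \<phi> z)"
      by (rule loc_integrable_test_fun[OF u test_fun_dt[OF \<phi>]])
    have "(LINT x|lborel. u0 x * \<phi> (x, 0)) = (LINT x|lborel. u0 x * \<psi> x * \<theta> 0)"
      by (simp add: \<phi>_def mult.assoc)
    also have "\<dots> = (LINT x|lborel. u0 x * \<psi> x) * \<theta> 0" by simp
    also have "\<dots> \<le> M * \<theta> 0"
      using M \<theta>0 by (intro mult_right_mono)
    finally have "- (LINT z:Q|lborel. u z * dt \<phi> z) \<le> M * \<theta> 0 + DIM('a) * (L * \<theta> 0) / 2 * B"
      using weak_solution_flux[OF ws \<xi>_meas \<xi> wg flux \<phi>] fl by linarith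
    also have "\<dots> = \<theta> 0 * ?A" by (simp add: algebra_simps)
    also have "\<dots> \<le> (b - a) * ?A"
      using \<theta>(2) A by (intro mult_right_mono)
    finally have *: "(LINT z:Q|lborel. - (u z * dt \<phi> z)) \<le> (b - a) * ?A"
      by (simp add: set_lebesgue_integral_def)
    have "(\<integral>\<^sup>+t. ennreal (\<kappa> t) * \<mu> t \<partial>lborel)
        = (\<integral>\<^sup>+t. \<integral>\<^sup>+x. ennreal (\<kappa> (snd (x, t))) * ennreal (\<psi> (fst (x, t)) * u (x, t)) \<partial>lborel \<partial>lborel)"
      by (simp add: \<mu>_def nn_integral_cmult)
    also have "\<dots> = (\<integral>\<^sup>+z. ennreal (\<kappa> (snd z)) * ennreal (\<psi> (fst z) * u z) \<partial>lborel)"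
      by (rule nn_integral_slices[symmetric]) measurable
    \<comment> \<open>The values of u at t \<le> 0 are arbitrary; they drop out because \<kappa> is
      supported in (a, b) and 0 \<le> a.\<close>
    also have "\<dots> = (\<integral>\<^sup>+z. ennreal (indicator Q z *\<^sub>R - (u z * dt \<phi> z)) \<partial>lborel)"
    proof (intro nn_integral_cong)
      fix z
      show "ennreal (\<kappa> (snd z)) * ennreal (\<psi> (fst z) * u z) = ennreal (indicator Q z *\<^sub>R - (u z * dt \<phi> z))"
      proof (cases "z \<in> Q")
        case True
        then show ?thesis using \<kappa>(1)
          by (simp add: dt ennreal_mult'[symmetric] mult_ac)
      next
        case False
        then have "snd z \<le> 0" by (cases z) (auto simp: Q_def)
        then have "\<kappa> (snd z) = 0" using ab by (intro \<kappa>(3)) auto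
        then show ?thesis using False by simp
      qed
    qed
    also have "\<dots> = ennreal (LINT z:Q|lborel. - (u z * dt \<phi> z))"
      unfolding set_lebesgue_integral_def
    proof (rule nn_integral_eq_integral)
      show "integrable lborel (\<lambda>z. indicator Q z *\<^sub>R - (u z * dt \<phi> z))"
        using int by (simp add: set_integrable_def)
      show "AE z in lborel. 0 \<le> indicator Q z *\<^sub>R - (u z * dt \<phi> z)"
        using u_nonneg
      proof eventually_elim
        case (elim z)
        then show ?case
          using \<kappa>(1)[of "snd z"] \<psi>(2)[of "fst z"] by (cases "z \<in> Q") (auto simp: dt)
      qed
    qed
    also have "\<dots> \<le> ennreal ((b - a) * ?A)"
      by (rule ennreal_leI[OF *])
    finally show ?thesis .
  qed
  \<comment> \<open>The first factor climbs from 0 at a to 1 at a + 1/n, the second falls from 1 at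
    b - 1/n to 0 at b. Each point of (a, b) eventually has weight 1, so Fatou's lemma recovers the
    indicator.\<close>
  define \<kappa> where "\<kappa> n t = step (real n * t + (- real n * a)) * step (- real n * t + real n * b)" for n t
  have "(\<integral>\<^sup>+t\<in>{a<..<b}. \<mu> t \<partial>lborel) \<le> (\<integral>\<^sup>+t. liminf (\<lambda>n. ennreal (\<kappa> n t) * \<mu> t) \<partial>lborel)"
  proof (rule nn_integral_mono)
    fix t
    show "\<mu> t * indicator {a<..<b} t \<le> liminf (\<lambda>n. ennreal (\<kappa> n t) * \<mu> t)"
    proof (cases "t \<in> {a<..<b}")
      case True
      then have t: "0 < t - a" "0 < b - t" by auto
      obtain N1 N2 where N: "1 < real N1 * (t - a)" "1 < real N2 * (b - t)"
        using reals_Archimedean3[OF t(1)] reals_Archimedean3[OF t(2)] by metis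
      have "\<kappa> n t = 1" if n: "max N1 N2 \<le> n" for n
      proof -
        have "real N1 * (t - a) \<le> real n * (t - a)" "real N2 * (b - t) \<le> real n * (b - t)"
          using n t by (auto intro!: mult_right_mono)
        then have "1 \<le> real n * t + (- real n * a)" "1 \<le> - real n * t + real n * b"
          using N by (auto simp: algebra_simps)
        then show ?thesis by (simp add: \<kappa>_def step_eq_1)
      qed
      then have "\<forall>\<^sub>F n in sequentially. \<mu> t \<le> ennreal (\<kappa> n t) * \<mu> t"
        unfolding eventually_sequentially by (intro exI[of _ "max N1 N2"]) auto
      from Liminf_bounded[OF this] show ?thesis using True by simp
    qed simp
  qed
  also have "\<dots> \<le> liminf (\<lambda>n. \<integral>\<^sup>+t. ennreal (\<kappa> n t) * \<mu> t \<partial>lborel)"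
  proof (rule nn_integral_liminf)
    fix n
    have "continuous_on UNIV (\<kappa> n)"
      unfolding \<kappa>_def[abs_def] by (intro smooth_continuous allI C_k_mult C_k_step_affine)
    then have [measurable]: "\<kappa> n \<in> borel_measurable borel" by (rule borel_measurable_continuous_onI)
    show "(\<lambda>t. ennreal (\<kappa> n t) * \<mu> t) \<in> borel_measurable lborel" by measurable
  qed
  also have "\<dots> \<le> liminf (\<lambda>n. ennreal ((b - a) * ?A))"
  proof (intro Liminf_mono always_eventually allI smooth_bound)
    fix n t
    show "C_k k (\<kappa> n)" for k
      unfolding \<kappa>_def[abs_def] by (intro C_k_mult C_k_step_affine)
    show "0 \<le> \<kappa> n t" "\<kappa> n t \<le> 1"
      by (auto simp: \<kappa>_def step_bounds intro!: mult_le_one)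
    show "\<kappa> n t = 0" if "t \<notin> {a<..<b}"
    proof -
      have "real n * (t - a) \<le> 0 \<or> real n * (b - t) \<le> 0"
        using that by (auto simp: mult_le_0_iff)
      then show ?thesis
        using step_eq_0[of "real n * t + (- real n * a)"] step_eq_0[of "- real n * t + real n * b"]
        by (auto simp: \<kappa>_def algebra_simps)
    qed
  qed
  also have "\<dots> = ennreal ((b - a) * ?A)" by (simp add: Liminf_const)
  finally show ?thesis unfolding \<mu>_def .
qed


section \<open>From time averages to almost every time\<close>

lemma AE_le_of_interval_bounds:
  fixes \<mu> :: "real \<Rightarrow> ennreal"
  assumes [measurable]: "\<mu> \<in> borel_measurable borel" and A: "0 \<le> A"
    and bound: "\<And>a b. 0 \<le> a \<Longrightarrow> a < b \<Longrightarrow> b \<le> T \<Longrightarrow> (\<integral>\<^sup>+t\<in>{a<..<b}. \<mu> t \<partial>lborel) \<le> ennreal ((b - a) * A)"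
  shows "AE t in lborel. 0 < t \<and> t < T \<longrightarrow> \<mu> t \<le> ennreal A"
proof (cases "0 < T")
  case T: True
  \<comment> \<open>Lebesgue differentiation needs a real-valued function. \<open>enn2real\<close>
    sends \<infinity> to 0, which loses only a null set: the bound on (0, T) makes \<mu> finite
    almost everywhere there.\<close>
  define f where "f t = enn2real (\<mu> t) * indicator {0<..<T} t" for t
  have [measurable]: "f \<in> borel_measurable borel" unfolding f_def by measurable
  have f_nonneg: "0 \<le> f t" for t by (simp add: f_def)
  have f_le: "ennreal (f t) \<le> \<mu> t * indicator {0<..<T} t" for t
    by (auto simp: f_def indicator_def ennreal_enn2real_if)
  have fin: "(\<integral>\<^sup>+t\<in>{0<..<T}. \<mu> t \<partial>lborel) < \<infinity>"
    using bound[of 0 T] T by (auto intro: le_less_trans)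
  then have "(\<integral>\<^sup>+t. ennreal (f t) \<partial>lborel) < \<infinity>"
    using nn_integral_mono[of lborel "\<lambda>t. ennreal (f t)", OF f_le] by (rule le_less_trans[rotated])
  then have int: "integrable lborel f"
    by (intro integrableI_nonneg) (auto simp: f_nonneg)
  have int': "set_integrable lborel (cbox a b) f" for a b
    unfolding set_integrable_def by (rule integrable_mult_indicator[OF _ int]) simp
  have avg: "integral (cbox x (x + h)) f \<le> h * A" if "0 < x" "0 < h" "x + h \<le> T" for x h
  proof -
    have "ennreal (LINT t:cbox x (x + h)|lborel. f t) = (\<integral>\<^sup>+t. ennreal (indicator (cbox x (x + h)) t *\<^sub>R f t) \<partial>lborel)"
      unfolding set_lebesgue_integral_def
      by (rule nn_integral_eq_integral[symmetric]) (use int' f_nonneg in \<open>auto simp: set_integrable_def\<close>)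
    also have "\<dots> \<le> (\<integral>\<^sup>+t\<in>{x<..<x+h}. \<mu> t \<partial>lborel)"
    proof (rule nn_integral_mono_AE)
      show "AE t in lborel. ennreal (indicator (cbox x (x + h)) t *\<^sub>R f t) \<le> \<mu> t * indicator {x<..<x+h} t"
        using AE_lborel_singleton[of x] AE_lborel_singleton[of "x + h"]
      proof eventually_elim
        case (elim t)
        show ?case
        proof (cases "t \<in> {x<..<x+h}")
          case True
          then show ?thesis using f_le[of t] that by simp
        next
          case False
          then show ?thesis using elim by auto
        qed
      qed
    qed
    also have "\<dots> \<le> ennreal (h * A)" using bound[of x "x + h"] that by simp
    finally have "(LINT t:cbox x (x + h)|lborel. f t) \<le> h * A"
      using that A by (subst (asm) ennreal_le_iff) auto
    then show ?thesis using set_borel_integral_eq_integral(2)[OF int'] by simp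
  qed
  \<comment> \<open>The averages are one-sided, over [x, x + h], and so match the interval bounds as
    long as x + h \<le> T.\<close>
  obtain N where N: "negligible N"
    "\<And>x e. x \<notin> N \<Longrightarrow> 0 < e \<Longrightarrow> \<exists>d>0. \<forall>h. 0 < h \<and> h < d \<longrightarrow>
        norm (integral (cbox x (x + h *\<^sub>R One)) f /\<^sub>R h ^ DIM(real) - f x) < e"
    using integrable_ccontinuous_explicit[OF set_borel_integral_eq_integral(1)[OF int']] by metis
  have pt: "f x \<le> A" if x: "x \<notin> N" "0 < x" "x < T" for x
  proof (rule field_le_epsilon)
    fix e :: real assume "0 < e"
    then obtain d where d: "0 < d" "\<And>h. 0 < h \<Longrightarrow> h < d \<Longrightarrow> norm (integral (cbox x (x + h)) f / h - f x) < e"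
      using N(2)[OF x(1), of e] by (auto simp: divide_inverse mult.commute)
    \<comment> \<open>Halving d makes h < d strict; the cap T - x keeps the interval inside [0, T]
      and is positive because x < T.\<close>
    define h where "h = min (d / 2) (T - x)"
    have h: "0 < h" "h < d" "x + h \<le> T" using d x by (auto simp: h_def)
    have "f x - e < integral (cbox x (x + h)) f / h" using d(2)[OF h(1,2)] by auto
    also have "\<dots> \<le> A" using avg[OF x(2) h(1,3)] h by (simp add: field_simps)
    finally show "f x \<le> A + e" by simp
  qed
  have "AE t in lborel. t \<notin> N"
  proof -
    have "AE t in lebesgue. t \<notin> N"
      using N(1) by (intro AE_not_in) (simp add: negligible_iff_null_sets)
    then show ?thesis by (simp add: AE_completion_iff)
  qed
  moreover have "AE t in lborel. \<mu> t * indicator {0<..<T} t \<noteq> \<infinity>"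
    using fin by (intro nn_integral_PInf_AE) auto
  ultimately show ?thesis
  proof eventually_elim
    case (elim t)
    show ?case
    proof
      assume t: "0 < t \<and> t < T"
      then have "\<mu> t < \<infinity>" using elim by (auto simp: less_top)
      then have "\<mu> t = ennreal (f t)" using t by (simp add: f_def)
      also have "\<dots> \<le> ennreal A" using pt elim t by (intro ennreal_leI) auto
      finally show "\<mu> t \<le> ennreal A" .
    qed
  qed
qed auto

text \<open>(T, T + 1) is not a null set. The energy estimate may fail at T itself, so it is used at
  some later time.\<close>

lemma AE_lborel_exists_gt:
  assumes "AE t in lborel. P t"
  shows "\<exists>t>(T::real). P t"
proof (rule ccontr)
  assume "\<not> ?thesis"
  then have "AE t in lborel. t \<notin> {T<..<T+1}"
    using assms by (auto elim: eventually_mono)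
  then have "{T<..<T+1} \<in> null_sets lborel"
    by (subst AE_iff_null_sets) auto
  then show False by auto
qed


section \<open>Assembling the moment bound\<close>

lemma first_moment_bound:
  fixes u0 :: "'a::euclidean_space \<Rightarrow> real"
  assumes u0_meas: "u0 \<in> borel_measurable borel"
    and u0_nonneg: "AE x in lborel. 0 \<le> u0 x"
    and u0_L2: "L2_fun u0"
  shows "\<exists>C :: real \<Rightarrow> real. \<forall>u p Du.
    weak_solution s u0 u p Du \<and> mass_conservation u0 u \<and> energy_estimate s u0 u p Du \<longrightarrow>
    (\<forall>T>0. AE t in lborel. 0 < t \<and> t \<le> T \<longrightarrow>
      (\<integral>\<^sup>+x. ennreal (norm x * u (x, t)) \<partial>lborel)
        \<le> (\<integral>\<^sup>+x. ennreal (norm x * u0 x) \<partial>lborel) + ennreal (C T))"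
proof (cases "(\<integral>\<^sup>+x. ennreal (norm x * u0 x) \<partial>lborel) = \<infinity>")
  case True
  show ?thesis unfolding True by simp
next
  case False
  note [measurable] = u0_meas
  have moment_int: "integrable lborel (\<lambda>x. norm x * u0 x)"
    using False u0_nonneg by (intro integrableI_nonneg) (auto simp: less_top elim: eventually_mono)
  \<comment> \<open>Inside the unit ball |u0| \<le> 1 + u0^2, outside it |u0| \<le> |x| |u0|. The
    majorant adds up the three contributions.\<close>
  have u0_int: "integrable lborel u0"
  proof (rule Bochner_Integration.integrable_bound)
    show "integrable lborel (\<lambda>x. norm (norm x * u0 x) + indicator (cball 0 1) x *\<^sub>R 1 + (norm (u0 x))\<^sup>2)"
      using u0_L2 moment_int emeasure_bounded_finite[OF bounded_cball, of "0::'a" 1]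
      by (intro Bochner_Integration.integrable_add integrable_norm)
         (auto simp: L2_fun_def intro!: integrable_real_indicator)
    have "norm (u0 x) \<le> norm (norm (norm x * u0 x) + indicator (cball 0 1) x *\<^sub>R 1 + (norm (u0 x))\<^sup>2)" for x
    proof (cases "norm x \<le> 1")
      case True
      have "0 \<le> (\<bar>u0 x\<bar> - 1)\<^sup>2 + 1 + \<bar>u0 x\<bar>\<^sup>2" by simp
      then have "\<bar>u0 x\<bar> \<le> 1 + (u0 x)\<^sup>2" by (simp add: power2_diff)
      moreover have "0 \<le> norm x * \<bar>u0 x\<bar>" by simp
      ultimately have "\<bar>u0 x\<bar> \<le> norm x * \<bar>u0 x\<bar> + 1 + (u0 x)\<^sup>2" by linarith
      then show ?thesis using True by (simp add: abs_mult)
    next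
      case False
      then have "\<bar>u0 x\<bar> * 1 \<le> \<bar>u0 x\<bar> * norm x" by (intro mult_left_mono) auto
      then have "\<bar>u0 x\<bar> \<le> norm x * \<bar>u0 x\<bar> + (u0 x)\<^sup>2"
        using zero_le_power2[of "u0 x"] by (simp add: mult.commute add_increasing2)
      then show ?thesis using False by (simp add: abs_mult)
    qed
    then show "AE x in lborel. norm (u0 x)
        \<le> norm (norm (norm x * u0 x) + indicator (cball 0 1) x *\<^sub>R 1 + (norm (u0 x))\<^sup>2)" by simp
  qed simp
  define m where "m = (LINT x|lborel. u0 x)"
  define w where "w = (LINT x|lborel. norm x * u0 x)"
  define e where "e = enn2real (ennreal (1/2) * (\<integral>\<^sup>+x. ennreal ((frac_lap (s / 2) u0 x)\<^sup>2) \<partial>lborel))"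
  have m: "(\<integral>\<^sup>+x. ennreal (u0 x) \<partial>lborel) = ennreal m" "0 \<le> m"
    unfolding m_def using u0_int u0_nonneg by (auto intro: nn_integral_eq_integral integral_nonneg_AE)
  have moment_nonneg: "AE x in lborel. 0 \<le> norm x * u0 x"
    using u0_nonneg by eventually_elim simp
  have w: "(\<integral>\<^sup>+x. ennreal (norm x * u0 x) \<partial>lborel) = ennreal w" "0 \<le> w"
    unfolding w_def using moment_int moment_nonneg
    by (auto intro: nn_integral_eq_integral integral_nonneg_AE)
  have e: "ennreal (1/2) * (\<integral>\<^sup>+x. ennreal ((frac_lap (s / 2) u0 x)\<^sup>2) \<partial>lborel) = ennreal e" "0 \<le> e"
    using frac_lap_square_integrable[of "s / 2" u0]
    by (auto simp: e_def ennreal_enn2real_if ennreal_mult_eq_top_iff)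
  obtain \<psi> :: "nat \<Rightarrow> 'a \<Rightarrow> real" and L
    where \<psi>: "0 \<le> L" "\<And>n. test_fun UNIV (\<psi> n)" "\<And>n x. 0 \<le> \<psi> n x" "\<And>n x. \<psi> n x \<le> 1 + norm x"
      "\<And>n x b. b \<in> Basis \<Longrightarrow> \<bar>frechet_derivative (\<psi> n) (at x) b\<bar> \<le> L"
      "\<And>x. \<forall>\<^sub>F n in sequentially. norm x \<le> \<psi> n x"
    using spatial_weights by metis
  have [measurable]: "\<psi> n \<in> borel_measurable borel" for n
    by (rule test_fun_measurable[OF \<psi>(2)])
  have initial: "(LINT x|lborel. u0 x * \<psi> n x) \<le> m + w" for n
  proof -
    have int: "integrable lborel (\<lambda>x. u0 x + norm x * u0 x)"
      using u0_int moment_int by simp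
    have le: "AE x in lborel. 0 \<le> u0 x * \<psi> n x \<and> u0 x * \<psi> n x \<le> u0 x + norm x * u0 x"
      using u0_nonneg
    proof eventually_elim
      case (elim x)
      then show ?case
        using \<psi>(3)[of n x] mult_left_mono[OF \<psi>(4)[of n x] elim] by (simp add: algebra_simps)
    qed
    have "integrable lborel (\<lambda>x. u0 x * \<psi> n x)"
      by (rule Bochner_Integration.integrable_bound[OF int]) (use le in \<open>auto elim: eventually_mono\<close>)
    then have "(LINT x|lborel. u0 x * \<psi> n x) \<le> (LINT x|lborel. u0 x + norm x * u0 x)"
      using int le by (intro integral_mono_AE) (auto elim: eventually_mono)
    then show ?thesis using u0_int moment_int by (simp add: m_def w_def)
  qed
  \<comment> \<open>The leading \<open>m\<close> is the cost of weights bounded by 1 + |x| instead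
    of |x|. In the bracket, \<open>m * T\<close> is the space-time integral of u over (0, T] by mass
    conservation, and the initial energy \<open>e\<close> bounds that of |\<xi>|^2.\<close>
  define C where "C T = m + DIM('a) * L / 2 * (m * T + e)" for T
  show ?thesis
  proof (intro exI[of _ C] allI impI)
    fix u :: "'a \<times> real \<Rightarrow> real" and p Du and T :: real
    assume asm: "weak_solution s u0 u p Du \<and> mass_conservation u0 u \<and> energy_estimate s u0 u p Du"
      and T: "0 < T"
    then have ws: "weak_solution s u0 u p Du" by simp
    from asm obtain \<xi> G where \<xi>_meas: "\<xi> \<in> borel_measurable borel"
      and \<xi>_fin: "(\<integral>\<^sup>+r\<in>{0<..}. (\<integral>\<^sup>+x. ennreal ((norm (\<xi> (x, r)))\<^sup>2) \<partial>lborel) \<partial>lborel) < \<infinity>"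
      and wg: "weak_grad_x (\<lambda>z. u z * p z) G"
      and flux: "AE z in lborel. z \<in> Q \<longrightarrow> G z - p z *\<^sub>R Du z = sqrt (u z) *\<^sub>R \<xi> z"
      and energy: "AE t in lborel. 0 < t \<longrightarrow>
        ennreal (1/2) * (\<integral>\<^sup>+x. ennreal ((frac_lap (s / 2) (\<lambda>y. u (y, t)) x)\<^sup>2) \<partial>lborel)
        + (\<integral>\<^sup>+r\<in>{0<..t}. (\<integral>\<^sup>+x. ennreal ((norm (\<xi> (x, r)))\<^sup>2) \<partial>lborel) \<partial>lborel)
        \<le> ennreal (1/2) * (\<integral>\<^sup>+x. ennreal ((frac_lap (s / 2) u0 x)\<^sup>2) \<partial>lborel)"
      unfolding energy_estimate_def by blast
    have u_meas: "u \<in> borel_measurable borel"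
      using ws by (auto simp: weak_solution_def Linf_sobolev_def)
    note [measurable] = u_meas \<xi>_meas slice_measurable[OF u_meas] slice_measurable[OF \<xi>_meas]
    have [measurable]: "(\<lambda>t. \<integral>\<^sup>+x. ennreal (u (x, t)) \<partial>lborel) \<in> borel_measurable borel"
      "(\<lambda>t. \<integral>\<^sup>+x. ennreal ((norm (\<xi> (x, t)))\<^sup>2) \<partial>lborel) \<in> borel_measurable borel"
      by (intro nn_integral_slice_measurable[of "\<lambda>z. ennreal (u z)"]
          nn_integral_slice_measurable[of "\<lambda>z. ennreal ((norm (\<xi> z))\<^sup>2)"]; measurable)+
    have \<xi>: "set_integrable lborel Q (\<lambda>z. (norm (\<xi> z))\<^sup>2)"
      unfolding set_integrable_def
    proof (rule integrableI_nonneg)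
      have "(\<integral>\<^sup>+z. ennreal (indicator Q z *\<^sub>R (norm (\<xi> z))\<^sup>2) \<partial>lborel)
          = (\<integral>\<^sup>+t. \<integral>\<^sup>+x. ennreal (indicator Q (x, t) *\<^sub>R (norm (\<xi> (x, t)))\<^sup>2) \<partial>lborel \<partial>lborel)"
        by (rule nn_integral_slices) measurable
      also have "\<dots> = (\<integral>\<^sup>+t. \<integral>\<^sup>+x. ennreal ((norm (\<xi> (x, t)))\<^sup>2) * indicator {0<..} t \<partial>lborel \<partial>lborel)"
        by (intro nn_integral_cong) (auto simp: Q_def indicator_def)
      also have "\<dots> < \<infinity>" using \<xi>_fin by (simp add: nn_integral_multc)
      finally show "(\<integral>\<^sup>+z. ennreal (indicator Q z *\<^sub>R (norm (\<xi> z))\<^sup>2) \<partial>lborel) < \<infinity>" .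
    qed auto
    have mass: "(\<integral>\<^sup>+t\<in>{0<..T}. (\<integral>\<^sup>+x. ennreal (u (x, t)) \<partial>lborel) \<partial>lborel) \<le> ennreal (m * T)"
    proof -
      have "AE t in lborel. (\<integral>\<^sup>+x. ennreal (u (x, t)) \<partial>lborel) * indicator {0<..T} t \<le> ennreal m * indicator {0<..T} t"
        using asm m(1) by (auto simp: mass_conservation_def indicator_def elim: eventually_mono)
      then have "(\<integral>\<^sup>+t\<in>{0<..T}. (\<integral>\<^sup>+x. ennreal (u (x, t)) \<partial>lborel) \<partial>lborel)
          \<le> (\<integral>\<^sup>+t. ennreal m * indicator {0<..T} t \<partial>lborel)"
        by (rule nn_integral_mono_AE)
      also have "\<dots> = ennreal (m * T)"
        using T m(2) by (subst nn_integral_cmult_indicator) (auto simp: ennreal_mult)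
      finally show ?thesis .
    qed
    have dissipation: "(\<integral>\<^sup>+t\<in>{0<..T}. (\<integral>\<^sup>+x. ennreal ((norm (\<xi> (x, t)))\<^sup>2) \<partial>lborel) \<partial>lborel) \<le> ennreal e"
    proof -
      obtain t where t: "T < t" "(\<integral>\<^sup>+r\<in>{0<..t}. (\<integral>\<^sup>+x. ennreal ((norm (\<xi> (x, r)))\<^sup>2) \<partial>lborel) \<partial>lborel) \<le> ennreal e"
      \<comment> \<open>A time t > T at which the energy estimate holds: the dissipation up to t
        dominates that up to T.\<close>
      proof -
        obtain t where t: "T < t" and en: "0 < t \<longrightarrow>
            ennreal (1/2) * (\<integral>\<^sup>+x. ennreal ((frac_lap (s / 2) (\<lambda>y. u (y, t)) x)\<^sup>2) \<partial>lborel)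
            + (\<integral>\<^sup>+r\<in>{0<..t}. (\<integral>\<^sup>+x. ennreal ((norm (\<xi> (x, r)))\<^sup>2) \<partial>lborel) \<partial>lborel) \<le> ennreal e"
          using AE_lborel_exists_gt[OF energy] unfolding e(1) by blast
        have "0 < t" using t T by simp
        from order_trans[OF add_increasing[OF zero_le order_refl] mp[OF en this]] t
        show ?thesis by (rule that[rotated])
      qed
      have "(\<integral>\<^sup>+t\<in>{0<..T}. (\<integral>\<^sup>+x. ennreal ((norm (\<xi> (x, t)))\<^sup>2) \<partial>lborel) \<partial>lborel)
          \<le> (\<integral>\<^sup>+r\<in>{0<..t}. (\<integral>\<^sup>+x. ennreal ((norm (\<xi> (x, r)))\<^sup>2) \<partial>lborel) \<partial>lborel)"
        using t(1) by (intro nn_integral_mono) (auto simp: indicator_def)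
      then show ?thesis using t(2) by (rule order_trans)
    qed
    have B: "(\<integral>\<^sup>+t\<in>{0<..T}. (\<integral>\<^sup>+x. ennreal (u (x, t)) + ennreal ((norm (\<xi> (x, t)))\<^sup>2) \<partial>lborel) \<partial>lborel)
        \<le> ennreal (m * T + e)"
    proof -
      have "(\<integral>\<^sup>+t\<in>{0<..T}. (\<integral>\<^sup>+x. ennreal (u (x, t)) + ennreal ((norm (\<xi> (x, t)))\<^sup>2) \<partial>lborel) \<partial>lborel)
        = (\<integral>\<^sup>+t\<in>{0<..T}. (\<integral>\<^sup>+x. ennreal (u (x, t)) \<partial>lborel) \<partial>lborel)
          + (\<integral>\<^sup>+t\<in>{0<..T}. (\<integral>\<^sup>+x. ennreal ((norm (\<xi> (x, t)))\<^sup>2) \<partial>lborel) \<partial>lborel)"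
        by (simp add: nn_integral_add distrib_right)
      also have "\<dots> \<le> ennreal (m * T) + ennreal e"
        by (intro add_mono mass dissipation)
      also have "\<dots> = ennreal (m * T + e)"
        using m(2) e(2) T by (simp add: ennreal_plus)
      finally show ?thesis .
    qed
    have B_nonneg: "0 \<le> m * T + e" using m(2) e(2) T by simp
    define A where "A = m + w + DIM('a) * L / 2 * (m * T + e)"
    have A: "0 \<le> A" unfolding A_def using m(2) w(2) \<psi>(1) B_nonneg by simp
    have "AE t in lborel. 0 < t \<and> t < T \<longrightarrow> (\<integral>\<^sup>+x. ennreal (\<psi> n x * u (x, t)) \<partial>lborel) \<le> ennreal A" for n
    proof (rule AE_le_of_interval_bounds[OF _ A])
      have [measurable]: "fst \<in> borel_measurable (borel :: ('a \<times> real) measure)"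
        by (intro borel_measurable_continuous_onI continuous_intros)
      show "(\<lambda>t. \<integral>\<^sup>+x. ennreal (\<psi> n x * u (x, t)) \<partial>lborel) \<in> borel_measurable borel"
        using nn_integral_slice_measurable[of "\<lambda>z. ennreal (\<psi> n (fst z) * u z)"] by simp
      show "(\<integral>\<^sup>+t\<in>{a<..<b}. (\<integral>\<^sup>+x. ennreal (\<psi> n x * u (x, t)) \<partial>lborel) \<partial>lborel) \<le> ennreal ((b - a) * A)"
        if "0 \<le> a" "a < b" "b \<le> T" for a b
        unfolding A_def
        by (rule weighted_interval_bound[OF ws \<xi>_meas \<xi> wg flux B B_nonneg \<psi>(2,3,1,5) initial _ that])
           (use m(2) w(2) in auto)
    qed
    \<comment> \<open>A single null set for all n, so that Fatou's lemma can be applied at fixed t.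
      The endpoint t = T, excluded by the strict inequality, is removed as a further null
      set.\<close>
    then have "AE t in lborel. \<forall>n. 0 < t \<and> t < T \<longrightarrow> (\<integral>\<^sup>+x. ennreal (\<psi> n x * u (x, t)) \<partial>lborel) \<le> ennreal A"
      unfolding AE_all_countable by blast
    then show "AE t in lborel. 0 < t \<and> t \<le> T \<longrightarrow>
        (\<integral>\<^sup>+x. ennreal (norm x * u (x, t)) \<partial>lborel)
          \<le> (\<integral>\<^sup>+x. ennreal (norm x * u0 x) \<partial>lborel) + ennreal (C T)"
      using AE_lborel_singleton[of T]
    proof eventually_elim
      case (elim t)
      show ?case
      proof
        assume t: "0 < t \<and> t \<le> T"
        have "(\<integral>\<^sup>+x. ennreal (norm x * u (x, t)) \<partial>lborel)
            \<le> (\<integral>\<^sup>+x. liminf (\<lambda>n. ennreal (\<psi> n x * u (x, t))) \<partial>lborel)"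
        proof (rule nn_integral_mono)
          fix x
          show "ennreal (norm x * u (x, t)) \<le> liminf (\<lambda>n. ennreal (\<psi> n x * u (x, t)))"
          \<comment> \<open>u is nonnegative only almost everywhere in space-time. Where it is
            negative, \<open>ennreal\<close> truncates the left-hand side to 0, and the inequality
            is trivial.\<close>
          proof (cases "0 \<le> u (x, t)")
            case True
            show ?thesis
              by (rule Liminf_bounded)
                 (use \<psi>(6)[of x] True in \<open>auto intro!: ennreal_leI mult_right_mono elim!: eventually_mono\<close>)
          next
            case False
            then have "ennreal (norm x * u (x, t)) = 0" by (simp add: ennreal_eq_0_iff mult_nonneg_nonpos)
            then show ?thesis by simp
          qed
        qed
        also have "\<dots> \<le> liminf (\<lambda>n. \<integral>\<^sup>+x. ennreal (\<psi> n x * u (x, t)) \<partial>lborel)"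
          by (rule nn_integral_liminf) measurable
        also have "\<dots> \<le> liminf (\<lambda>n. ennreal A)"
          using elim t by (intro Liminf_mono always_eventually) auto
        also have "\<dots> = ennreal A" by (simp add: Liminf_const)
        also have "\<dots> = ennreal (w + C T)"
          by (simp add: A_def C_def algebra_simps)
        also have "\<dots> = ennreal w + ennreal (C T)"
          using w(2) m(2) \<psi>(1) B_nonneg by (intro ennreal_plus) (auto simp: C_def)
        finally show "(\<integral>\<^sup>+x. ennreal (norm x * u (x, t)) \<partial>lborel)
          \<le> (\<integral>\<^sup>+x. ennreal (norm x * u0 x) \<partial>lborel) + ennreal (C T)"
          unfolding w(1) .
      qed
    qed
  qed
qed

theorem lemma3p2:
  fixes s :: real and u0 :: "real ^ 'd \<Rightarrow> real"
  assumes s: "0 < s" "s < 1"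
    and u0_meas: "u0 \<in> borel_measurable borel"
    and u0_nonneg: "AE x in lborel. 0 \<le> u0 x"
    and u0_sobolev: "sobolev s u0"
    and u0_entropy: "entropy u0 < \<infinity>"
  shows "\<exists>C :: real \<Rightarrow> real. \<forall>u p Du.
    weak_solution s u0 u p Du \<and> constructed s u0 u \<and>
    mass_conservation u0 u \<and> entropy_estimate s u0 u Du \<and> energy_estimate s u0 u p Du \<longrightarrow>
    (\<forall>T>0. AE t in lborel. 0 < t \<and> t \<le> T \<longrightarrow>
      (\<integral>\<^sup>+x. ennreal (norm x * u (x, t)) \<partial>lborel)
        \<le> (\<integral>\<^sup>+x. ennreal (norm x * u0 x) \<partial>lborel) + ennreal (C T))"
proof -
  have "L2_fun u0" using u0_sobolev by (simp add: sobolev_def)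
  from first_moment_bound[OF u0_meas u0_nonneg this, of s] show ?thesis by blast
qed

end
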